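(* Given a directed or undirected graph $G$ with $n$ vertices, its vertices can be output in a BFS order starting at a given vertex in polynomial time using $n\lg 3+o(n)$ bits of working space.
   Context: Model: the input graph is stored in read-only memory as a standard adjacency list, output goes to write-only memory, and only the additional random-access workspace is counted, in bits; the workspace is a word RAM with words of $\Omega(\lg n)$ bits. As a standing assumption of the paper, the input graph is connected. *)

theory Defs
  imports "Graph_Theory.Digraph_Component" "Graph_Theory.Shortest_Path" "HOL-Library.Landau_Symbols"
begin

section \<open>A word RAM with read-only input and write-only output\<close>

text \<open>
  A program is a list of instructions over finitely many registers.  A machine of word length \<open>w\<close>
  has these registers and a random-access workspace; each register and each workspace cell is
  a natural number below \<open>2 ^ w\<close>.  The input memory is only accessible through
  \<open>Read\<close> and the output only through \<open>Write\<close>.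
\<close>

type_synonym reg = nat

datatype alu = Add | Sub | Mul | Div | Mod | And | Or | Xor | Shl | Shr

datatype instr =
    Const reg nat
  | Alu alu reg reg reg
  | Load reg reg
  | Store reg reg
  | Read reg reg
  | Write reg
  | Jump nat
  | Jump_Less reg reg nat
  | Jump_Eq reg reg nat
  | Halt

fun alu_op :: "alu \<Rightarrow> nat \<Rightarrow> nat \<Rightarrow> nat \<Rightarrow> nat" where
  "alu_op Add w x y = (x + y) mod 2 ^ w"
| "alu_op Sub w x y = (x + (2 ^ w - y)) mod 2 ^ w"
| "alu_op Mul w x y = (x * y) mod 2 ^ w"
| "alu_op Div w x y = x div y"
| "alu_op Mod w x y = x mod y"
| "alu_op And w x y = Bit_Operations.and x y"
| "alu_op Or w x y = Bit_Operations.or x y"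
| "alu_op Xor w x y = Bit_Operations.xor x y"
| "alu_op Shl w x y = push_bit y x mod 2 ^ w"
| "alu_op Shr w x y = drop_bit y x"

record config =
  pc :: nat
  regs :: "reg \<Rightarrow> nat"
  ws :: "nat list"
  outp :: "nat list"

abbreviation set_reg :: "reg \<Rightarrow> nat \<Rightarrow> config \<Rightarrow> config" where
  "set_reg i x c \<equiv> c\<lparr>pc := Suc (pc c), regs := (regs c)(i := x)\<rparr>"

text \<open>
  The result \<open>None\<close> means that no step is possible: the machine has halted, or it faults, which
  includes every access outside the input or outside the \<open>length (ws c)\<close> workspace cells.
\<close>

fun exec :: "nat \<Rightarrow> nat list \<Rightarrow> instr \<Rightarrow> config \<Rightarrow> config option" where
  "exec w inp (Const i k) c = Some (set_reg i (k mod 2 ^ w) c)"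
| "exec w inp (Alu f i j k) c = Some (set_reg i (alu_op f w (regs c j) (regs c k)) c)"
| "exec w inp (Load i j) c =
    (if regs c j < length (ws c) then Some (set_reg i (ws c ! regs c j) c) else None)"
| "exec w inp (Store i j) c =
    (if regs c i < length (ws c)
     then Some (c\<lparr>pc := Suc (pc c), ws := (ws c)[regs c i := regs c j]\<rparr>) else None)"
| "exec w inp (Read i j) c =
    (if regs c j < length inp then Some (set_reg i (inp ! regs c j) c) else None)"
| "exec w inp (Write i) c = Some (c\<lparr>pc := Suc (pc c), outp := outp c @ [regs c i]\<rparr>)"
| "exec w inp (Jump l) c = Some (c\<lparr>pc := l\<rparr>)"
| "exec w inp (Jump_Less i j l) c =
    Some (c\<lparr>pc := (if regs c i < regs c j then l else Suc (pc c))\<rparr>)"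
| "exec w inp (Jump_Eq i j l) c =
    Some (c\<lparr>pc := (if regs c i = regs c j then l else Suc (pc c))\<rparr>)"
| "exec w inp Halt c = None"

definition step :: "instr list \<Rightarrow> nat \<Rightarrow> nat list \<Rightarrow> config \<Rightarrow> config option" where
  "step P w inp c = (if pc c < length P then exec w inp (P ! pc c) c else None)"

fun run :: "instr list \<Rightarrow> nat \<Rightarrow> nat list \<Rightarrow> nat \<Rightarrow> config \<Rightarrow> config option" where
  "run P w inp 0 c = Some c"
| "run P w inp (Suc t) c = Option.bind (step P w inp c) (run P w inp t)"

definition init :: "nat \<Rightarrow> config" where
  "init M = \<lparr>pc = 0, regs = (\<lambda>_. 0), ws = replicate M 0, outp = []\<rparr>"

definition halts_with ::
  "instr list \<Rightarrow> nat \<Rightarrow> nat list \<Rightarrow> nat \<Rightarrow> nat \<Rightarrow> nat list \<Rightarrow> bool" where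
  "halts_with P w inp M t vs \<longleftrightarrow>
    (\<exists>c. run P w inp t (init M) = Some c \<and> pc c < length P \<and> P ! pc c = Halt \<and> outp c = vs)"

fun regs_of :: "instr \<Rightarrow> reg set" where
  "regs_of (Const i k) = {i}"
| "regs_of (Alu f i j k) = {i, j, k}"
| "regs_of (Load i j) = {i, j}"
| "regs_of (Store i j) = {i, j}"
| "regs_of (Read i j) = {i, j}"
| "regs_of (Write i) = {i}"
| "regs_of (Jump l) = {}"
| "regs_of (Jump_Less i j l) = {i, j}"
| "regs_of (Jump_Eq i j l) = {i, j}"
| "regs_of Halt = {}"

text \<open>
  Working space in bits: the registers occurring in the program are charged
  as well as the \<open>M\<close> workspace cells.
\<close>

definition space_bits :: "instr list \<Rightarrow> nat \<Rightarrow> nat \<Rightarrow> nat" where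
  "space_bits P w M = (card (\<Union> (regs_of ` set P)) + M) * w"

section \<open>Adjacency lists\<close>

text \<open>
  A linked list node at address \<open>p\<close> occupies the cells \<open>p\<close> (entry) and \<open>p + 1\<close> (address of the next
  node).  Address \<open>0\<close> is the null pointer.
\<close>

fun linked_list :: "nat list \<Rightarrow> nat \<Rightarrow> nat list \<Rightarrow> bool" where
  "linked_list inp p [] \<longleftrightarrow> p = 0"
| "linked_list inp p (x # xs) \<longleftrightarrow>
    p \<noteq> 0 \<and> Suc p < length inp \<and> inp ! p = x \<and> linked_list inp (inp ! Suc p) xs"

text \<open>
  Input memory: the number \<open>n\<close> of vertices, the start vertex, \<open>n\<close> list heads, and
  the list nodes in any arrangement.  The list of \<open>v\<close> contains every out-neighbour
  of \<open>v\<close> once, in any order.  An undirected graph is a digraph with symmetric arc set, so an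
  edge is listed at both of its ends.
\<close>

definition adjacency_list :: "nat pair_pre_digraph \<Rightarrow> nat \<Rightarrow> nat list \<Rightarrow> bool" where
  "adjacency_list G s inp \<longleftrightarrow>
    (let n = card (pverts G) in
      pverts G = {0..<n} \<and> s \<in> pverts G \<and>
      n + 2 \<le> length inp \<and> inp ! 0 = n \<and> inp ! 1 = s \<and>
      (\<forall>v<n. \<exists>xs. linked_list inp (inp ! (v + 2)) xs \<and> distinct xs \<and>
        set xs = {u. (v, u) \<in> parcs G}))"

text \<open>The input consists of words, and a word can hold every input address.\<close>

definition fits_words :: "nat \<Rightarrow> nat list \<Rightarrow> bool" where
  "fits_words w inp \<longleftrightarrow> length inp \<le> 2 ^ w \<and> (\<forall>x\<in>set inp. x < 2 ^ w)"

text \<open>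
  \<open>w n\<close> is the word length for graphs with \<open>n\<close> vertices.  Every register costs \<open>w n\<close> bits, so a
  working space of \<open>c * n + o(n)\<close> bits presupposes that \<open>w\<close> is sublinear.
\<close>

definition word_length :: "(nat \<Rightarrow> nat) \<Rightarrow> bool" where
  "word_length w \<longleftrightarrow>
    (\<lambda>n. real (w n)) \<in> \<Omega>(\<lambda>n. log 2 (real n)) \<and> (\<lambda>n. real (w n)) \<in> o(\<lambda>n. real n)"

section \<open>BFS orders\<close>

definition distance :: "'a pair_pre_digraph \<Rightarrow> 'a \<Rightarrow> 'a \<Rightarrow> ereal" where
  "distance G u v = wf_digraph.\<mu> (with_proj G) (\<lambda>_. 1) u v"

text \<open>
  The search from \<open>s\<close> visits the vertices reachable from \<open>s\<close> level by level; the order within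
  a level is free.
\<close>

definition bfs_order :: "'a pair_pre_digraph \<Rightarrow> 'a \<Rightarrow> 'a list \<Rightarrow> bool" where
  "bfs_order G s vs \<longleftrightarrow>
    distinct vs \<and> set vs = {v. s \<rightarrow>\<^sup>*\<^bsub>with_proj G\<^esub> v} \<and>
    sorted_wrt (\<lambda>u v. distance G s u \<le> distance G s v) vs"

end

theory Submission
  imports Defs
begin

text \<open>
  The search colours every vertex white (unvisited), grey or black.  A phase turns all grey
  vertices black and then scans the adjacency lists of all black vertices; each white neighbour
  found becomes grey and is output.  When phase \<open>i\<close> scans, the black vertices are exactly
  those at distance at most \<open>i\<close>, so the new grey ones are those at distance \<open>i + 1\<close>.
  Rescanning old black vertices costs only time and makes it unnecessary to tell
  the current level apart from the finished ones; hence three colours suffice.  After \<open>n\<close> phases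
  every reachable vertex has been output.

  The colours are ternary digits, \<open>k\<close> of them to a word, where \<open>k\<close> is maximal with
  \<open>3 ^ k < 2 ^ w\<close> and is computed by the machine itself.  A colour only ever grows by one, which
  is the addition of a power of three to a word.  A word wastes at most \<open>lg 3\<close> of its \<open>w\<close> bits,
  and \<open>w\<close> tends to infinity, so the total waste is \<open>o(n)\<close>.
\<close>

section \<open>Structured code\<close>

lemma run_add: "run P w inp (a + b) c = Option.bind (run P w inp a c) (run P w inp b)"
proof (induction a arbitrary: c)
  case (Suc a)
  then show ?case by (cases "step P w inp c") simp_all
qed simp

lemma run_trans:
  assumes "run P w inp a c = Some c'" "run P w inp b c' = Some c''"
  shows "run P w inp (a + b) c = Some c''"
  using assms by (simp add: run_add)

text \<open>Code is given as a function of the address at which it is placed.\<close>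

type_synonym code = "nat \<Rightarrow> instr list"

definition code_at :: "instr list \<Rightarrow> nat \<Rightarrow> instr list \<Rightarrow> bool" where
  "code_at P a xs \<longleftrightarrow> (\<exists>ys zs. P = ys @ xs @ zs \<and> length ys = a)"

lemma code_at_append:
  assumes "code_at P a (xs @ ys)"
  shows "code_at P a xs" "code_at P (a + length xs) ys"
proof -
  obtain us vs where P: "P = us @ (xs @ ys) @ vs" "length us = a"
    using assms unfolding code_at_def by blast
  show "code_at P a xs"
    unfolding code_at_def by (rule exI[of _ us], rule exI[of _ "ys @ vs"]) (simp add: P)
  show "code_at P (a + length xs) ys"
    unfolding code_at_def by (rule exI[of _ "us @ xs"], rule exI[of _ vs]) (simp add: P)
qed

lemma code_at_Cons:
  assumes "code_at P a (x # xs)"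
  shows "a < length P" "P ! a = x" "code_at P (Suc a) xs"
proof -
  show "a < length P" "P ! a = x" using assms by (auto simp: code_at_def)
  show "code_at P (Suc a) xs" using code_at_append(2)[of P a "[x]" xs] assms by simp
qed

definition state :: "nat \<Rightarrow> (reg \<Rightarrow> nat) \<Rightarrow> nat list \<Rightarrow> nat list \<Rightarrow> config" where
  "state a r m os = \<lparr>pc = a, regs = r, ws = m, outp = os\<rparr>"

datatype test = Eq reg reg | Less reg reg

fun holds :: "test \<Rightarrow> (reg \<Rightarrow> nat) \<Rightarrow> bool" where
  "holds (Eq i j) r \<longleftrightarrow> r i = r j"
| "holds (Less i j) r \<longleftrightarrow> r i < r j"

fun jump_if :: "test \<Rightarrow> nat \<Rightarrow> instr" where
  "jump_if (Eq i j) l = Jump_Eq i j l"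
| "jump_if (Less i j) l = Jump_Less i j l"

definition ins :: "instr \<Rightarrow> code" where
  "ins i = (\<lambda>_. [i])"

definition seqc :: "code \<Rightarrow> code \<Rightarrow> code" (infixr \<open>;;\<close> 60) where
  "C ;; D = (\<lambda>a. C a @ D (a + length (C a)))"

text \<open>The loop is left as soon as the test at its head holds. Besides the body, the exit
  address skips the test and the closing jump, hence the \<open>2\<close>; jumps are absolute, so
  the body is generated for its own address \<open>Suc a\<close>.\<close>

definition until :: "test \<Rightarrow> code \<Rightarrow> code" where
  "until b C = (\<lambda>a. jump_if b (a + length (C (Suc a)) + 2) # C (Suc a) @ [Jump a])"

text \<open>Jumps are taken on a true test only, so a true test hops over the jump that leads past
  the body. This costs one step if the test holds and two if it fails.\<close>

definition guard :: "test \<Rightarrow> code \<Rightarrow> code" where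
  "guard b C = (\<lambda>a. jump_if b (a + 2) # Jump (a + 2 + length (C (a + 2))) # C (a + 2))"

text \<open>
  Started in the given state with the clock at \<open>t\<close>, the code runs through to its
  end and establishes \<open>Q\<close>, which may speak about the clock as well.
\<close>

definition wp :: "nat \<Rightarrow> nat list \<Rightarrow> code \<Rightarrow>
    (nat \<Rightarrow> (reg \<Rightarrow> nat) \<Rightarrow> nat list \<Rightarrow> nat list \<Rightarrow> bool) \<Rightarrow>
    nat \<Rightarrow> (reg \<Rightarrow> nat) \<Rightarrow> nat list \<Rightarrow> nat list \<Rightarrow> bool" where
  "wp w inp C Q t r m os \<longleftrightarrow>
    (\<forall>P a. code_at P a (C a) \<longrightarrow>
      (\<exists>d r' m' os'. run P w inp d (state a r m os) = Some (state (a + length (C a)) r' m' os') \<and>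
        Q (t + d) r' m' os'))"

lemma run_witness:
  assumes "run P w inp d c = Some (state b r m os)" "Q (t + d) r m os"
  shows "\<exists>d r' m' os'. run P w inp d c = Some (state b r' m' os') \<and> Q (t + d) r' m' os'"
  using assms by blast

section \<open>Proof rules for instructions, branches and loops\<close>

lemma wp_mono:
  assumes "wp w inp C Q t r m os" "\<And>t r m os. Q t r m os \<Longrightarrow> Q' t r m os"
  shows "wp w inp C Q' t r m os"
  unfolding wp_def
proof (intro allI impI)
  fix P a assume "code_at P a (C a)"
  then obtain d r' m' os' where
    "run P w inp d (state a r m os) = Some (state (a + length (C a)) r' m' os')" "Q (t + d) r' m' os'"
    using assms(1) unfolding wp_def by blast
  then show "\<exists>d r' m' os'. run P w inp d (state a r m os) =
      Some (state (a + length (C a)) r' m' os') \<and> Q' (t + d) r' m' os'"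
    using assms(2) by blast
qed

lemma wp_seqc:
  assumes "wp w inp C (wp w inp D Q) t r m os"
  shows "wp w inp (C ;; D) Q t r m os"
  unfolding wp_def
proof (intro allI impI)
  fix P a assume "code_at P a ((C ;; D) a)"
  then have C: "code_at P a (C a)" and D: "code_at P (a + length (C a)) (D (a + length (C a)))"
    by (auto simp: seqc_def dest: code_at_append)
  obtain d r1 m1 os1 where 1: "run P w inp d (state a r m os) = Some (state (a + length (C a)) r1 m1 os1)"
    "wp w inp D Q (t + d) r1 m1 os1"
    using assms C unfolding wp_def[of _ _ C] by blast
  obtain d' r2 m2 os2 where
    "run P w inp d' (state (a + length (C a)) r1 m1 os1) =
      Some (state (a + length (C a) + length (D (a + length (C a)))) r2 m2 os2)"
    "Q (t + d + d') r2 m2 os2"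
    using 1(2) D unfolding wp_def by blast
  with run_trans[OF 1(1)] show "\<exists>d r' m' os'. run P w inp d (state a r m os) =
      Some (state (a + length ((C ;; D) a)) r' m' os') \<and> Q (t + d) r' m' os'"
    by (intro run_witness[of _ _ _ "d + d'"]) (auto simp: seqc_def add.assoc)
qed

lemma step_state:
  assumes "code_at P a (i # is)" "exec w inp i (state a r m os) = Some c"
  shows "step P w inp (state a r m os) = Some c"
  using code_at_Cons[OF assms(1)] assms(2) by (simp add: step_def state_def)

lemma wp_ins:
  assumes "\<And>a. exec w inp i (state a r m os) = Some (state (Suc a) r' m' os')" "Q (Suc t) r' m' os'"
  shows "wp w inp (ins i) Q t r m os"
  unfolding wp_def ins_def
proof (intro allI impI)
  fix P a assume "code_at P a [i]"
  then have "run P w inp 1 (state a r m os) = Some (state (Suc a) r' m' os')"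
    using step_state assms(1) by simp
  then show "\<exists>d r' m' os'. run P w inp d (state a r m os) =
      Some (state (a + length [i]) r' m' os') \<and> Q (t + d) r' m' os'"
    using assms(2) by (intro run_witness[of _ _ _ 1]) auto
qed

lemma wp_Const:
  "Q (Suc t) (r(i := c mod 2 ^ w)) m os \<Longrightarrow> wp w inp (ins (Const i c)) Q t r m os"
  by (rule wp_ins) (auto simp: state_def)

lemma wp_Alu:
  "Q (Suc t) (r(i := alu_op f w (r j) (r k))) m os \<Longrightarrow> wp w inp (ins (Alu f i j k)) Q t r m os"
  by (rule wp_ins) (auto simp: state_def)

lemma wp_Load:
  "r j < length m \<Longrightarrow> Q (Suc t) (r(i := m ! r j)) m os \<Longrightarrow> wp w inp (ins (Load i j)) Q t r m os"
  by (rule wp_ins) (auto simp: state_def)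

lemma wp_Store:
  "r i < length m \<Longrightarrow> Q (Suc t) r (m[r i := r j]) os \<Longrightarrow> wp w inp (ins (Store i j)) Q t r m os"
  by (rule wp_ins) (auto simp: state_def)

lemma wp_Read:
  "r j < length inp \<Longrightarrow> Q (Suc t) (r(i := inp ! r j)) m os \<Longrightarrow> wp w inp (ins (Read i j)) Q t r m os"
  by (rule wp_ins) (auto simp: state_def)

lemma wp_Write:
  "Q (Suc t) r m (os @ [r i]) \<Longrightarrow> wp w inp (ins (Write i)) Q t r m os"
  by (rule wp_ins) (auto simp: state_def)

lemma exec_jump_if:
  "exec w inp (jump_if b l) (state a r m os) = Some (state (if holds b r then l else Suc a) r m os)"
  by (cases b) (auto simp: state_def)

lemma wp_guard:
  assumes "holds b r \<Longrightarrow> wp w inp C Q (Suc t) r m os" "\<not> holds b r \<Longrightarrow> Q (t + 2) r m os"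
  shows "wp w inp (guard b C) Q t r m os"
  unfolding wp_def
proof (intro allI impI)
  fix P a assume "code_at P a (guard b C a)"
  then have 1: "code_at P a (jump_if b (a + 2) # Jump (a + 2 + length (C (a + 2))) # C (a + 2))"
    by (simp add: guard_def)
  note 2 = code_at_Cons(3)[OF 1]
  note 3 = code_at_Cons(3)[OF 2]
  have s: "run P w inp 1 (state a r m os) = Some (state (if holds b r then a + 2 else Suc a) r m os)"
    using step_state[OF 1 exec_jump_if] by simp
  show "\<exists>d r' m' os'. run P w inp d (state a r m os) =
      Some (state (a + length (guard b C a)) r' m' os') \<and> Q (t + d) r' m' os'"
  proof (cases "holds b r")
    case True
    have "code_at P (a + 2) (C (a + 2))" using 3 by simp
    with assms(1)[OF True] obtain d r' m' os' where
      "run P w inp d (state (a + 2) r m os) = Some (state (a + 2 + length (C (a + 2))) r' m' os')"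
      "Q (Suc t + d) r' m' os'"
      unfolding wp_def by blast
    with run_trans[OF s] True show ?thesis
      by (intro run_witness[of _ _ _ "1 + d"]) (auto simp: guard_def add.assoc)
  next
    case False
    have "run P w inp 1 (state (Suc a) r m os) = Some (state (a + 2 + length (C (a + 2))) r m os)"
      using step_state[OF 2] by (simp add: state_def)
    with run_trans[OF s] False assms(2) show ?thesis
      by (intro run_witness[of _ _ _ "1 + 1"]) (auto simp: guard_def)
  qed
qed

lemma wp_until_true:
  assumes "holds b r" "Q (Suc t) r m os"
  shows "wp w inp (until b C) Q t r m os"
  unfolding wp_def
proof (intro allI impI)
  fix P a assume "code_at P a (until b C a)"
  then have 1: "code_at P a (jump_if b (a + length (C (Suc a)) + 2) # C (Suc a) @ [Jump a])"
    by (simp add: until_def)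
  then show "\<exists>d r' m' os'. run P w inp d (state a r m os) =
      Some (state (a + length (until b C a)) r' m' os') \<and> Q (t + d) r' m' os'"
    using step_state[OF 1 exec_jump_if] assms
    by (intro run_witness[of _ _ _ 1]) (auto simp: until_def)
qed

text \<open>The test and the closing jump take one step each, which accounts for the
  \<open>Suc t\<close> before the body and the one after it.\<close>

lemma wp_until_false:
  assumes "\<not> holds b r" "wp w inp C (\<lambda>t. wp w inp (until b C) Q (Suc t)) (Suc t) r m os"
  shows "wp w inp (until b C) Q t r m os"
  unfolding wp_def
proof (intro allI impI)
  fix P a assume P: "code_at P a (until b C a)"
  then have 1: "code_at P a (jump_if b (a + length (C (Suc a)) + 2) # C (Suc a) @ [Jump a])"
    by (simp add: until_def)
  note 2 = code_at_append[OF code_at_Cons(3)[OF 1]]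
  have s: "run P w inp 1 (state a r m os) = Some (state (Suc a) r m os)"
    using step_state[OF 1 exec_jump_if] assms(1) by simp
  obtain d r1 m1 os1 where
    d: "run P w inp d (state (Suc a) r m os) = Some (state (Suc a + length (C (Suc a))) r1 m1 os1)"
    and l: "wp w inp (until b C) Q (Suc (Suc t + d)) r1 m1 os1"
    using assms(2) 2(1) unfolding wp_def[of _ _ C] by blast
  have j: "run P w inp 1 (state (Suc a + length (C (Suc a))) r1 m1 os1) = Some (state a r1 m1 os1)"
    using step_state[OF 2(2)] by (simp add: state_def)
  obtain d' r2 m2 os2 where
    "run P w inp d' (state a r1 m1 os1) = Some (state (a + length (until b C a)) r2 m2 os2)"
    "Q (Suc (Suc t + d) + d') r2 m2 os2"
    using l P unfolding wp_def by blast
  with run_trans[OF s run_trans[OF d run_trans[OF j]]]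
  show "\<exists>d r' m' os'. run P w inp d (state a r m os) =
      Some (state (a + length (until b C a)) r' m' os') \<and> Q (t + d) r' m' os'"
    by (intro run_witness[of _ _ _ "1 + (d + (1 + d'))"]) (auto simp: add.assoc)
qed

text \<open>The first argument of the invariant is the exact number of remaining rounds.\<close>

lemma wp_until:
  assumes "I j t r m os"
    and "\<And>t r m os. I 0 t r m os \<Longrightarrow> holds b r \<and> Q (Suc t) r m os"
    and "\<And>j t r m os. I (Suc j) t r m os \<Longrightarrow>
      \<not> holds b r \<and> wp w inp C (\<lambda>t. I j (Suc t)) (Suc t) r m os"
  shows "wp w inp (until b C) Q t r m os"
  using assms(1)
proof (induction j arbitrary: t r m os)
  case 0
  then show ?case using assms(2) by (intro wp_until_true) auto
next
  case (Suc j)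
  have "\<not> holds b r" and body: "wp w inp C (\<lambda>t. I j (Suc t)) (Suc t) r m os"
    using assms(3)[OF Suc.prems] by auto
  then show ?case by (intro wp_until_false wp_mono[OF body] Suc.IH)
qed

lemmas wp_intros = wp_seqc wp_Const wp_Alu wp_Load wp_Store wp_Read wp_Write wp_guard

section \<open>Ternary digits\<close>

text \<open>A ternary digit below \<open>2\<close> grows by one without a carry, so the part of the
  number above position \<open>i\<close> does not change.\<close>

lemma div_power_add_power:
  fixes x :: nat
  assumes "x div 3 ^ i mod 3 < 2" "i < j"
  shows "(x + 3 ^ i) div 3 ^ j = x div 3 ^ j"
proof -
  \<comment> \<open>Division by \<open>3 ^ j\<close> passes through division by \<open>3 ^ i\<close>
    and then by \<open>3\<close>, and the latter already drops the changed digit.\<close>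
  have s: "y div 3 ^ j = y div 3 ^ i div 3 div 3 ^ (j - Suc i)" for y :: nat
  proof -
    have "j = i + 1 + (j - Suc i)" using assms(2) by simp
    then have "(3::nat) ^ j = 3 ^ i * 3 * 3 ^ (j - Suc i)" by (metis power_add power_one_right)
    then show ?thesis by (simp only: div_mult2_eq)
  qed
  have "y mod 3 < 2 \<Longrightarrow> (y + 1) div 3 = y div 3" for y :: nat by presburger
  with assms(1) have "(x div 3 ^ i + 1) div 3 = x div 3 ^ i div 3" by blast
  then show ?thesis unfolding s by simp
qed

text \<open>Digits above \<open>i\<close> receive no carry, digit \<open>i\<close> itself gains one,
  and for \<open>j < i\<close> the summand is a multiple of \<open>3 ^ Suc j\<close>.\<close>

lemma digit_add_power:
  fixes x :: nat
  assumes "x div 3 ^ i mod 3 < 2"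
  shows "(x + 3 ^ i) div 3 ^ j mod 3 = x div 3 ^ j mod 3 + (if j = i then 1 else 0)"
proof (cases i j rule: linorder_cases)
  case less
  then show ?thesis using div_power_add_power[OF assms] by simp
next
  case equal
  have "y mod 3 < 2 \<Longrightarrow> (y + 1) mod 3 = y mod 3 + 1" for y :: nat by presburger
  with assms have "(x div 3 ^ i + 1) mod 3 = x div 3 ^ i mod 3 + 1" by blast
  then show ?thesis using equal by simp
next
  case greater
  then have "i = (i - Suc j) + 1 + j" by simp
  then have "(3::nat) ^ i = 3 ^ (i - Suc j) * 3 * 3 ^ j" by (metis power_add power_one_right)
  then have "(x + 3 ^ i) div 3 ^ j = x div 3 ^ j + 3 ^ (i - Suc j) * 3" by simp
  then show ?thesis using greater by simp
qed

text \<open>Without a carry out of position \<open>i\<close> the quotient by \<open>3 ^ j\<close>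
  remains zero. This is what keeps a packed word in range.\<close>

lemma add_power_less_power:
  fixes x :: nat
  assumes "x div 3 ^ i mod 3 < 2" "i < j" "x < 3 ^ j"
  shows "x + 3 ^ i < 3 ^ j"
  using div_power_add_power[OF assms(1,2)] assms(3) by (simp add: div_eq_0_iff)

section \<open>The program\<close>

text \<open>
  The numbering makes frame conditions intervals: the registers below \<open>6\<close> are constant after
  \<open>prepare\<close>, and every other piece of code only changes registers from some number on.
\<close>

abbreviation (input) ZERO :: reg where "ZERO \<equiv> 0"
abbreviation (input) ONE :: reg where "ONE \<equiv> 1"
abbreviation (input) TWO :: reg where "TWO \<equiv> 2"
abbreviation (input) THREE :: reg where "THREE \<equiv> 3"
abbreviation (input) NUM :: reg where "NUM \<equiv> 4"
abbreviation (input) TRITS :: reg where "TRITS \<equiv> 5"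
abbreviation (input) PHASE :: reg where "PHASE \<equiv> 6"
abbreviation (input) SOURCE :: reg where "SOURCE \<equiv> 7"
abbreviation (input) PTR :: reg where "PTR \<equiv> 8"
abbreviation (input) VERTEX :: reg where "VERTEX \<equiv> 9"
abbreviation (input) CELL :: reg where "CELL \<equiv> 10"
abbreviation (input) INDEX :: reg where "INDEX \<equiv> 11"
abbreviation (input) POW :: reg where "POW \<equiv> 12"
abbreviation (input) WORD :: reg where "WORD \<equiv> 13"
abbreviation (input) COLOUR :: reg where "COLOUR \<equiv> 14"

definition power_loop :: code where
  "power_loop = until (Eq INDEX ZERO)
    (ins (Alu Mul POW POW THREE) ;; ins (Alu Sub INDEX INDEX ONE))"

definition access :: code where
  "access = ins (Alu Div CELL VERTEX TRITS) ;; ins (Alu Mod INDEX VERTEX TRITS) ;;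
    ins (Const POW 1) ;; power_loop ;;
    ins (Load WORD CELL) ;; ins (Alu Div COLOUR WORD POW) ;; ins (Alu Mod COLOUR COLOUR THREE)"

text \<open>Relies on \<open>CELL\<close>, \<open>POW\<close> and \<open>WORD\<close> as
  \<open>access\<close> leaves them. The same code turns white into grey and grey into
  black.\<close>

definition bump :: code where
  "bump = ins (Alu Add WORD WORD POW) ;; ins (Store CELL WORD)"

definition promote :: code where
  "promote = ins (Const VERTEX 0) ;; until (Eq VERTEX NUM)
    (access ;; guard (Eq COLOUR ONE) bump ;; ins (Alu Add VERTEX VERTEX ONE))"

text \<open>The list heads start at address \<open>2\<close>, behind the number of vertices and the
  start vertex. A white neighbour changes colour when it is output, so it is never output
  again.\<close>

definition scan :: code where
  "scan = ins (Alu Add PTR SOURCE TWO) ;; ins (Read PTR PTR) ;; until (Eq PTR ZERO)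
    (ins (Read VERTEX PTR) ;; access ;; guard (Eq COLOUR ZERO) (bump ;; ins (Write VERTEX)) ;;
     ins (Alu Add PTR PTR ONE) ;; ins (Read PTR PTR))"

text \<open>Adding \<open>ZERO\<close> copies \<open>SOURCE\<close>, because \<open>scan\<close>
  overwrites \<open>VERTEX\<close>. Vertices found during the expansion are grey and fail the test
  for black, so they are not scanned in the same phase.\<close>

definition expand :: code where
  "expand = ins (Const SOURCE 0) ;; until (Eq SOURCE NUM)
    (ins (Alu Add VERTEX SOURCE ZERO) ;; access ;; guard (Eq COLOUR TWO) scan ;;
     ins (Alu Add SOURCE SOURCE ONE))"

text \<open>With \<open>(2 ^ w - 1) div 3\<close> in \<open>WORD\<close>, the test holds exactly
  when one more multiplication of \<open>POW\<close> by three would overflow.\<close>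

definition trits_loop :: code where
  "trits_loop = until (Less WORD POW)
    (ins (Alu Mul POW POW THREE) ;; ins (Alu Add TRITS TRITS ONE))"

text \<open>The difference of \<open>ZERO\<close> and \<open>ONE\<close> wraps around to the largest
  word, which is how the program learns the word length. \<open>ZERO\<close> and \<open>ONE\<close>
  double as the addresses of \<open>n\<close> and \<open>s\<close>; \<open>ZERO\<close>,
  \<open>TRITS\<close> and \<open>PHASE\<close> start from the initial register value
  \<open>0\<close>.\<close>

definition prepare :: code where
  "prepare = ins (Const ONE 1) ;; ins (Const TWO 2) ;; ins (Const THREE 3) ;; ins (Read NUM ZERO) ;;
    ins (Alu Sub WORD ZERO ONE) ;; ins (Alu Div WORD WORD THREE) ;; ins (Const POW 1) ;; trits_loop ;;
    ins (Read VERTEX ONE) ;; access ;; bump ;; ins (Write VERTEX)"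

definition bfs :: code where
  "bfs = prepare ;; until (Eq PHASE NUM) (promote ;; expand ;; ins (Alu Add PHASE PHASE ONE))"

text \<open>The graph enters only through the function \<open>adj\<close>, which keeps the
  verification of the program apart from digraph theory. The word length \<open>w\<close> is a fixed
  number here.\<close>

locale bfs_input =
  fixes w k :: nat and inp :: "nat list" and n s :: nat and adj :: "nat \<Rightarrow> nat set"
  assumes trits: "0 < k" "3 ^ k < (2::nat) ^ w" "2 ^ w \<le> (3::nat) ^ Suc k"
    and inp: "n + 2 \<le> length inp" "length inp \<le> 2 ^ w" "inp ! 0 = n" "inp ! 1 = s" "s < n"
    and adj_list: "v < n \<Longrightarrow> \<exists>xs. linked_list inp (inp ! (v + 2)) xs \<and> distinct xs \<and> set xs = adj v"
    and adj_less: "v < n \<Longrightarrow> adj v \<subseteq> {..<n}"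
begin

section \<open>Constant registers, word bounds and packed colours\<close>

definition const_regs :: "(reg \<Rightarrow> nat) \<Rightarrow> bool" where
  "const_regs r \<longleftrightarrow> r ZERO = 0 \<and> r ONE = 1 \<and> r TWO = 2 \<and> r THREE = 3 \<and> r NUM = n \<and> r TRITS = k"

lemma const_regs_frame: "const_regs r \<Longrightarrow> (\<And>x. x < 6 \<Longrightarrow> r' x = r x) \<Longrightarrow> const_regs r'"
  unfolding const_regs_def by simp

lemma const_regsD:
  assumes "const_regs r"
  shows "r ZERO = 0" "r (Suc 0) = 1" "r TWO = 2" "r THREE = 3" "r NUM = n" "r TRITS = k"
  using assms by (auto simp: const_regs_def)

lemma word_ge: "2 \<le> w"
proof (rule ccontr)
  assume "\<not> 2 \<le> w"
  then have "(2::nat) ^ w \<le> 2 ^ 1" by (intro power_increasing) auto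
  moreover have "(3::nat) ^ 1 \<le> 3 ^ k" using trits(1) by (intro power_increasing) auto
  ultimately show False using trits(2) by simp
qed

text \<open>The input has at least \<open>n + 2\<close> cells, all of them addressable. This keeps
  vertex numbers and loop counters from wrapping around.\<close>

lemma less_word: "x \<le> Suc n \<Longrightarrow> x < 2 ^ w"
  using inp by linarith

lemma three_less_word: "3 < (2::nat) ^ w"
proof -
  have "(2::nat) ^ 2 \<le> 2 ^ w" using word_ge by (intro power_increasing) auto
  then show ?thesis by simp
qed

text \<open>The number of cells is the one that the program is run with. The bound
  \<open>3 ^ k\<close> says that a cell consists of \<open>k\<close> digits only, and unlike a bound
  by \<open>2 ^ w\<close> it survives incrementing a digit below \<open>2\<close>.\<close>

definition good :: "nat list \<Rightarrow> bool" where
  "good m \<longleftrightarrow> length m = n div k + 1 \<and> (\<forall>x\<in>set m. x < 3 ^ k)"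

text \<open>White is \<open>0\<close>, grey is \<open>1\<close> and black is \<open>2\<close>.\<close>

definition col :: "nat list \<Rightarrow> nat \<Rightarrow> nat" where
  "col m v = m ! (v div k) div 3 ^ (v mod k) mod 3"

definition incr :: "nat list \<Rightarrow> nat \<Rightarrow> nat list" where
  "incr m v = m[v div k := m ! (v div k) + 3 ^ (v mod k)]"

lemma col_le: "col m v \<le> 2"
  unfolding col_def by linarith

lemma cell_less: "good m \<Longrightarrow> v < n \<Longrightarrow> v div k < length m"
  unfolding good_def by (simp add: div_le_mono less_Suc_eq_le)

lemma index_less: "v mod k < k"
  using trits(1) by simp

lemma incr_less:
  assumes "good m" "v < n" "col m v < 2"
  shows "m ! (v div k) + 3 ^ (v mod k) < 3 ^ k"
  using assms cell_less[OF assms(1,2)] index_less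
  by (intro add_power_less_power) (auto simp: good_def col_def)

lemma good_incr: "good m \<Longrightarrow> v < n \<Longrightarrow> col m v < 2 \<Longrightarrow> good (incr m v)"
  using incr_less by (fastforce simp: good_def incr_def dest: set_update_subset_insert[THEN subsetD])

lemma col_incr:
  assumes "good m" "v < n" "col m v < 2"
  shows "col (incr m v) u = (if u = v then col m v + 1 else col m u)"
proof (cases "u div k = v div k")
  case True
  have "col (incr m v) u = (m ! (v div k) + 3 ^ (v mod k)) div 3 ^ (u mod k) mod 3"
    using True cell_less[OF assms(1,2)] by (simp add: col_def incr_def)
  also have "\<dots> = col m u + (if u mod k = v mod k then 1 else 0)"
    using True assms(3) by (subst digit_add_power) (auto simp: col_def)
  also have "u mod k = v mod k \<longleftrightarrow> u = v" using True by (metis div_mult_mod_eq)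
  finally show ?thesis by auto
next
  case False
  then show ?thesis by (auto simp: col_def incr_def)
qed

section \<open>Correctness and running time of the subroutines\<close>

lemma wp_power_loop:
  assumes "r INDEX = i" "r POW = p" "p * 3 ^ i < 2 ^ w" "i < 2 ^ w"
    and "r ZERO = 0" "r ONE = 1" "r THREE = 3"
    and "\<And>t' r'. \<lbrakk>t' \<le> t + 4 * i + 1; r' POW = p * 3 ^ i; \<And>x. x \<noteq> INDEX \<Longrightarrow> x \<noteq> POW \<Longrightarrow> r' x = r x\<rbrakk>
      \<Longrightarrow> Q t' r' m os"
  shows "wp w inp power_loop Q t r m os"
  unfolding power_loop_def
\<comment> \<open>The product of \<open>POW\<close> and the outstanding power of three stays
  constant. A round takes four steps: test, two operations and the jump back.\<close>
proof (rule wp_until[where j = i and I = "\<lambda>j t' r' m' os'. m' = m \<and> os' = os \<and>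
    t' + 4 * j \<le> t + 4 * i \<and> j \<le> i \<and> r' INDEX = j \<and> r' POW * 3 ^ j = p * 3 ^ i \<and>
    (\<forall>x. x \<noteq> INDEX \<longrightarrow> x \<noteq> POW \<longrightarrow> r' x = r x)"], goal_cases)
  case 1
  then show ?case using assms by simp
next
  case (2 t' r' m' os')
  then show ?case using assms by (auto intro!: assms(8))
next
  case (3 j t' r' m' os')
  \<comment> \<open>Every intermediate power is bounded by the final one, so no multiplication wraps
    around.\<close>
  have "r' POW * 3 * 1 \<le> r' POW * 3 * 3 ^ j" by (intro mult_left_mono) auto
  also have "\<dots> = p * 3 ^ i" using 3 by (simp add: mult.assoc)
  finally have "r' POW * 3 < 2 ^ w" using assms(3) by simp
  moreover have "(Suc j + (2 ^ w - Suc 0)) mod 2 ^ w = j"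
  proof -
    have "Suc j + (2 ^ w - Suc 0) = j + 2 ^ w" using less_word[of 0] by simp
    then show ?thesis using 3 assms(4) by simp
  qed
  ultimately show ?case using 3 assms(5-7)
    by (intro conjI wp_intros) (auto simp: algebra_simps)
qed

lemma wp_access:
  assumes "const_regs r" "good m" "r VERTEX = v" "v < n"
    and "\<And>t' r'. \<lbrakk>t' \<le> t + 4 * k + 6; r' CELL = v div k; r' POW = 3 ^ (v mod k);
        r' WORD = m ! (v div k); r' COLOUR = col m v; \<And>x. x < 10 \<Longrightarrow> r' x = r x\<rbrakk> \<Longrightarrow> Q t' r' m os"
  shows "wp w inp access Q t r m os"
  unfolding access_def
proof (intro wp_intros, rule wp_power_loop[where i = "v mod k" and p = 1], goal_cases)
  case 3
  have "(3::nat) ^ (v mod k) \<le> 3 ^ k" using index_less by (intro power_increasing) (auto simp: less_imp_le)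
  from le_less_trans[OF this trits(2)] show ?case by simp
next
  case 4
  show ?case using less_word[of "v mod k"] assms(4) mod_less_eq_dividend[of v k] by linarith
next
  case (8 t' r')
  show ?case
  proof (intro wp_intros, goal_cases)
    case 1
    then show ?case using 8(3)[of 10] assms cell_less by (simp add: const_regsD)
  next
    case 2
    show ?case
    proof (rule assms(5), goal_cases)
      case 1
      then show ?case using 8(1) index_less[of v] by simp
    qed (use 8 assms in \<open>auto simp: const_regsD col_def\<close>)
  qed
qed (use assms three_less_word word_ge in \<open>auto simp: const_regsD\<close>)

lemma wp_bump:
  assumes "good m" "v < n" "col m v < 2"
    and "r CELL = v div k" "r POW = 3 ^ (v mod k)" "r WORD = m ! (v div k)"
    and "\<And>r'. (\<And>x. x < 10 \<Longrightarrow> r' x = r x) \<Longrightarrow> Q (t + 2) r' (incr m v) os"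
  shows "wp w inp bump Q t r m os"
  unfolding bump_def
proof (intro wp_intros, goal_cases)
  case 1
  then show ?case using assms cell_less by simp
next
  case 2
  \<comment> \<open>The new word stays below \<open>3 ^ k\<close>, so the addition modulo
    \<open>2 ^ w\<close> is exact.\<close>
  have "m ! (v div k) + 3 ^ (v mod k) < 2 ^ w"
    using incr_less[OF assms(1-3)] trits(2) by simp
  then show ?case using assms(4-6) assms(7)[of "r(WORD := m ! (v div k) + 3 ^ (v mod k))"]
    by (simp add: incr_def)
qed

lemma wp_promote:
  assumes "const_regs r" "good m"
    and "\<And>t' r' m'. \<lbrakk>t' \<le> t + n * (4 * k + 12) + 2; \<And>x. x < 9 \<Longrightarrow> r' x = r x; good m';
        \<And>v. v < n \<Longrightarrow> col m' v = (if col m v = 0 then 0 else 2)\<rbrakk> \<Longrightarrow> Q t' r' m' os"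
  shows "wp w inp promote Q t r m os"
  unfolding promote_def
\<comment> \<open>While \<open>j\<close> counts down, \<open>VERTEX\<close> counts up, so the
  vertices below \<open>n - j\<close> are the ones treated already.\<close>
proof (intro wp_intros, rule wp_until[where j = n and I = "\<lambda>j t' r' m' os'. os' = os \<and> j \<le> n \<and>
    t' + j * (4 * k + 12) \<le> t + n * (4 * k + 12) + 1 \<and> r' VERTEX = n - j \<and> (\<forall>x<9. r' x = r x) \<and>
    good m' \<and> (\<forall>v<n. col m' v = (if v < n - j \<and> col m v = 1 then 2 else col m v))"], goal_cases)
  case 1
  then show ?case using assms by simp
next
  case (2 t' r' m' os')
  have "col m v \<noteq> 1 \<Longrightarrow> col m v \<noteq> 0 \<Longrightarrow> col m v = 2" for v using col_le[of m v] by linarith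
  then show ?case using 2 assms by (auto simp: const_regsD intro!: assms(3))
next
  case (3 j t' r' m' os')
  let ?v = "n - Suc j"
  have c: "const_regs r'" using 3 by (intro const_regs_frame[OF assms(1)]) simp
  have v: "?v < n" "n - j = Suc ?v" using 3 by auto
  show ?case
  proof (rule conjI, goal_cases)
    case 1
    then show ?case using 3 c v by (simp add: const_regsD)
  next
    case 2
    show ?case
    proof (intro wp_intros, rule wp_access[OF c, of _ ?v], goal_cases)
      case (4 t1 r1)
      have c1: "const_regs r1" using 4 by (intro const_regs_frame[OF c]) simp
      have r1: "r1 VERTEX = ?v" "\<forall>x<9. r1 x = r x" using 3 4 by auto
      show ?case
      proof (intro wp_intros, goal_cases)
        case 1
        then have one: "col m' ?v = 1" using 4 c1 by (simp add: const_regsD)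
        show ?case
        proof (rule wp_bump[where v = ?v], goal_cases)
          case (7 r2)
          have c2: "const_regs r2" using 7 by (intro const_regs_frame[OF c1]) simp
          have r2: "r2 VERTEX = ?v" "\<forall>x<9. r2 x = r x" using 7 r1 by auto
          show ?case
            using c2 r2 v 3 4(1) one less_word[of "n - j"]
            by (intro wp_intros) (auto simp: const_regsD good_incr col_incr less_Suc_eq)
        qed (use 3 4 v one in auto)
      next
        case 2
        then have "col m' ?v \<noteq> 1" using 4 c1 by (simp add: const_regsD)
        then show ?case
          using c1 r1 v 3 4(1) less_word[of "n - j"]
          by (auto simp: const_regsD less_Suc_eq)
      qed
    qed (use 3 v in auto)
  qed
qed

lemma linked_list_Cons:
  assumes "linked_list inp p (x # xs)"
  shows "p \<noteq> 0" "Suc p < length inp" "inp ! p = x" "linked_list inp (inp ! Suc p) xs" "Suc p < 2 ^ w"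
  using assms inp(2) by auto

lemma wp_scan:
  assumes "const_regs r" "good m" "r SOURCE = u" "u < n"
    and "\<And>t' r' m' news. \<lbrakk>t' \<le> t + n * (4 * k + 16) + 3; \<And>x. x < 8 \<Longrightarrow> r' x = r x; good m';
        \<And>v. v < n \<Longrightarrow> col m' v = (if col m v = 0 \<and> v \<in> adj u then 1 else col m v);
        distinct news; set news = {v \<in> adj u. col m v = 0}\<rbrakk> \<Longrightarrow> Q t' r' m' (os @ news)"
  shows "wp w inp scan Q t r m os"
proof -
  obtain xs where xs: "linked_list inp (inp ! (u + 2)) xs" "distinct xs" "set xs = adj u"
    using adj_list[OF assms(4)] by blast
  \<comment> \<open>Neighbours are listed without repetition, so a list has at most \<open>n\<close>
    nodes; this bounds the number of rounds.\<close>
  have "card (set xs) \<le> card {..<n}" using xs(3) adj_less[OF assms(4)] by (intro card_mono) auto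
  then have "length xs \<le> n" using xs(2) by (simp add: distinct_card)
  then have len: "length xs * (4 * k + 16) \<le> n * (4 * k + 16)" by (intro mult_right_mono) auto
  have u: "u + 2 < length inp" "u + 2 < 2 ^ w" using assms(4) inp by auto
  \<comment> \<open>The list splits into the scanned part \<open>ys\<close> and the rest
    \<open>zs\<close> at which \<open>PTR\<close> points. Colours are compared with the memory
    \<open>m\<close> from before the scan.\<close>
  define I where "I j t' r' m' os' \<longleftrightarrow> (\<exists>ys zs news. xs = ys @ zs \<and> length zs = j \<and>
    t' + j * (4 * k + 16) \<le> t + 2 + length xs * (4 * k + 16) \<and> linked_list inp (r' PTR) zs \<and>
    (\<forall>x<8. r' x = r x) \<and> good m' \<and> os' = os @ news \<and> distinct news \<and>
    set news = {v \<in> set ys. col m v = 0} \<and>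
    (\<forall>v<n. col m' v = (if col m v = 0 \<and> v \<in> set ys then 1 else col m v)))"
    for j t' os' and r' :: "reg \<Rightarrow> nat" and m'
  show ?thesis
    unfolding scan_def
  proof (intro wp_intros, goal_cases)
    case 1
    show ?case using assms u by (simp add: const_regsD)
  next
    case 2
    show ?case
    proof (rule wp_until[where I = I and j = "length xs"], goal_cases)
      case 1
      show ?case unfolding I_def using xs(1) assms u
        by (intro exI[of _ "[]"] exI[of _ xs]) (auto simp: const_regsD)
    next
      case (2 t' r' m' os')
      then obtain news where I: "t' + 0 * (4 * k + 16) \<le> t + 2 + length xs * (4 * k + 16)" "r' PTR = 0"
        "\<forall>x<8. r' x = r x" "good m'" "os' = os @ news" "distinct news"
        "set news = {v \<in> adj u. col m v = 0}"
        "\<forall>v<n. col m' v = (if col m v = 0 \<and> v \<in> adj u then 1 else col m v)"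
        unfolding I_def using xs(3) by auto
      have "Suc t' \<le> t + n * (4 * k + 16) + 3" using I(1) len by linarith
      with I assms(1) show ?case by (auto simp: const_regsD intro!: assms(5))
    next
      case (3 j t' r' m' os')
      then obtain ys x zs news where ys: "xs = ys @ x # zs" "length zs = j"
        "t' + Suc j * (4 * k + 16) \<le> t + 2 + length xs * (4 * k + 16)"
        "linked_list inp (r' PTR) (x # zs)" "\<forall>x<8. r' x = r x" "good m'"
        "os' = os @ news" "distinct news" "set news = {v \<in> set ys. col m v = 0}"
        "\<forall>v<n. col m' v = (if col m v = 0 \<and> v \<in> set ys then 1 else col m v)"
        unfolding I_def by (auto simp: length_Suc_conv)
      note ptr = linked_list_Cons[OF ys(4)]
      have x: "x < n" "x \<notin> set ys" using ys(1) xs(2,3) adj_less[OF assms(4)] by auto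
      \<comment> \<open>As \<open>x\<close> has not occurred earlier in the list, it still has its
        colour from before the scan.\<close>
      have colx: "col m' x = col m x" using ys(10) x by simp
      have c: "const_regs r'" using ys(5) by (intro const_regs_frame[OF assms(1)]) simp
      \<comment> \<open>Both outcomes of the guard continue with this code; \<open>new\<close> is
        what the guard has output.\<close>
      have advance: "wp w inp (ins (Alu Add PTR PTR ONE) ;; ins (Read PTR PTR)) (\<lambda>t. I j (Suc t)) t2 r2 m2 (os @ news @ new)"
        if r2: "\<And>x. x < 9 \<Longrightarrow> r2 x = r' x" and t2: "t2 \<le> Suc t' + 4 * k + 12" and "good m2"
          "\<And>v. v < n \<Longrightarrow> col m2 v = (if v = x \<and> col m x = 0 then 1 else col m' v)"
          "new = (if col m x = 0 then [x] else [])" for t2 r2 m2 new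
      proof -
        have c2: "const_regs r2" using r2 by (intro const_regs_frame[OF c]) simp
        have p2: "r2 PTR = r' PTR" using r2[of 8] by simp
        show ?thesis
        proof (intro wp_intros, goal_cases)
          case 1
          then show ?case using c2 p2 ptr by (simp add: const_regsD)
        next
          case 2
          show ?case unfolding I_def
            by (rule exI[of _ "ys @ [x]"], rule exI[of _ zs], rule exI[of _ "news @ new"])
              (use that ys x ptr p2 c2 in \<open>auto simp: const_regsD split: if_splits\<close>)
        qed
      qed
      show ?case
      proof (rule conjI)
        show "\<not> holds (Eq PTR ZERO) r'" using ptr c by (simp add: const_regsD)
        show "wp w inp (ins (Read VERTEX PTR) ;; access ;; guard (Eq COLOUR ZERO) (bump ;; ins (Write VERTEX)) ;;
           ins (Alu Add PTR PTR ONE) ;; ins (Read PTR PTR)) (\<lambda>t. I j (Suc t)) (Suc t') r' m' os'"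
        proof (intro wp_intros, goal_cases)
          case 1
          then show ?case using ptr by simp
        next
          case 2
          show ?case
          proof (rule wp_access[of _ _ x], goal_cases)
            case 1
            then show ?case by (intro const_regs_frame[OF c]) simp
          next
            case (5 t1 r1)
            have c1: "const_regs r1" using 5 by (intro const_regs_frame[OF c]) simp
            have r1: "\<And>x. x < 9 \<Longrightarrow> r1 x = r' x" "r1 VERTEX = x" using 5 ptr by auto
            show ?case
            proof (rule wp_seqc, rule wp_guard, goal_cases)
              case 1
              then have zero: "col m x = 0" using 5 c1 colx by (simp add: const_regsD)
              show ?case
              proof (intro wp_seqc, rule wp_bump[where v = x], goal_cases)
                case (7 r2)
                show ?case
                proof (rule wp_Write)
                  have "wp w inp (ins (Alu Add PTR PTR ONE) ;; ins (Read PTR PTR)) (\<lambda>t. I j (Suc t))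
                    (Suc (Suc t1 + 2)) r2 (incr m' x) (os @ news @ [x])"
                    using 7 r1 5(1) ys(6) x colx zero
                    by (intro advance) (auto simp: good_incr col_incr)
                  then show "wp w inp (ins (Alu Add PTR PTR ONE) ;; ins (Read PTR PTR)) (\<lambda>t. I j (Suc t))
                    (Suc (Suc t1 + 2)) r2 (incr m' x) (os' @ [r2 VERTEX])"
                    using 7 r1(2) ys(7) by simp
                qed
              qed (use 5 ys x colx zero in auto)
            next
              case 2
              then have nonzero: "col m x \<noteq> 0" using 5 c1 colx by (simp add: const_regsD)
              have "wp w inp (ins (Alu Add PTR PTR ONE) ;; ins (Read PTR PTR)) (\<lambda>t. I j (Suc t))
                (t1 + 2) r1 m' (os @ news @ [])"
                using r1 5(1) ys(6) nonzero by (intro advance) auto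
              then show ?case using ys(7) by simp
            qed
          qed (use ys x ptr in auto)
        qed
      qed
    qed
  qed
qed

lemma wp_expand:
  assumes "const_regs r" "good m" "\<And>v. v < n \<Longrightarrow> col m v \<noteq> 1"
    and "\<And>t' r' m' news. \<lbrakk>t' \<le> t + n * (n * (4 * k + 16) + 4 * k + 16) + 2; \<And>x. x < 7 \<Longrightarrow> r' x = r x; good m';
        \<And>v. v < n \<Longrightarrow> col m' v = (if col m v = 0 \<and> (\<exists>u<n. col m u = 2 \<and> v \<in> adj u) then 1 else col m v);
        distinct news; set news = {v. v < n \<and> col m v = 0 \<and> (\<exists>u<n. col m u = 2 \<and> v \<in> adj u)}\<rbrakk>
        \<Longrightarrow> Q t' r' m' (os @ news)"
  shows "wp w inp expand Q t r m os"
proof -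
  \<comment> \<open>\<open>W i\<close> collects what the first \<open>i\<close> sources contribute,
    with black taken from the initial memory \<open>m\<close>.\<close>
  define W where "W i v \<longleftrightarrow> (\<exists>u<i. col m u = 2 \<and> v \<in> adj u)" for i v
  have W_Suc: "W (Suc i) v \<longleftrightarrow> W i v \<or> col m i = 2 \<and> v \<in> adj i" for i v
    by (auto simp: W_def less_Suc_eq)
  \<comment> \<open>Time allowance for one source: a full scan, the colour access and the loop
    overhead.\<close>
  define B where "B = n * (4 * k + 16) + 4 * k + 16"
  define I where "I j t' r' m' os' \<longleftrightarrow> (\<exists>news. j \<le> n \<and> r' SOURCE = n - j \<and>
    t' + j * B \<le> t + 1 + n * B \<and> (\<forall>x<7. r' x = r x) \<and> good m' \<and> os' = os @ news \<and> distinct news \<and>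
    set news = {v. v < n \<and> col m v = 0 \<and> W (n - j) v} \<and>
    (\<forall>v<n. col m' v = (if col m v = 0 \<and> W (n - j) v then 1 else col m v)))"
    for j t' os' and r' :: "reg \<Rightarrow> nat" and m'
  show ?thesis
    unfolding expand_def
  proof (intro wp_intros, rule wp_until[where I = I and j = n], goal_cases)
    case 1
    show ?case unfolding I_def using assms by (intro exI[of _ "[]"]) (auto simp: W_def)
  next
    case (2 t' r' m' os')
    then obtain news where I: "t' + 0 * B \<le> t + 1 + n * B" "r' SOURCE = n"
      "\<forall>x<7. r' x = r x" "good m'" "os' = os @ news" "distinct news"
      "set news = {v. v < n \<and> col m v = 0 \<and> W n v}"
      "\<forall>v<n. col m' v = (if col m v = 0 \<and> W n v then 1 else col m v)"
      unfolding I_def by auto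
    have "Suc t' \<le> t + n * (n * (4 * k + 16) + 4 * k + 16) + 2" using I(1) by (simp add: B_def)
    moreover have "Q (Suc t') r' m' (os @ news)" if "Suc t' \<le> t + n * (n * (4 * k + 16) + 4 * k + 16) + 2"
      using that I by (intro assms(4)) (auto simp: W_def)
    ultimately show ?case using I(2,3,5) assms(1) by (simp add: const_regsD)
  next
    case (3 j t' r' m' os')
    define u where "u = n - Suc j"
    from 3 obtain news where I: "Suc j \<le> n" "r' SOURCE = u" "t' + Suc j * B \<le> t + 1 + n * B"
      "\<forall>x<7. r' x = r x" "good m'" "os' = os @ news" "distinct news"
      "set news = {v. v < n \<and> col m v = 0 \<and> W u v}"
      "\<forall>v<n. col m' v = (if col m v = 0 \<and> W u v then 1 else col m v)"
      unfolding I_def u_def by blast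
    have u: "u < n" "n - j = Suc u" using I(1) by (auto simp: u_def)
    have c: "const_regs r'" using I(4) by (intro const_regs_frame[OF assms(1)]) simp
    \<comment> \<open>Scanning only turns white into grey. Hence the black vertices remain those of
      \<open>m\<close>, although the program reads the current memory.\<close>
    have two: "col m' u = 2 \<longleftrightarrow> col m u = 2" using I(9) u by auto
    have advance: "wp w inp (ins (Alu Add SOURCE SOURCE ONE)) (\<lambda>t. I j (Suc t)) t2 r2 m2 (os @ news @ new)"
      if r2: "\<And>x. x < 8 \<Longrightarrow> r2 x = r' x" and t2: "t2 + 2 \<le> t' + B" and "good m2"
        "\<And>v. v < n \<Longrightarrow> col m2 v = (if col m' v = 0 \<and> col m u = 2 \<and> v \<in> adj u then 1 else col m' v)"
        "distinct new" "set new = {v. col m u = 2 \<and> v \<in> adj u \<and> col m' v = 0}" for t2 r2 m2 new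
    proof -
      have c2: "const_regs r2" using r2 by (intro const_regs_frame[OF c]) simp
      have s2: "r2 SOURCE = u" using r2[of 7] I(2) by simp
      have "set new \<subseteq> {..<n}" using that(6) adj_less[OF u(1)] by auto
      \<comment> \<open>A white vertex found from an earlier source is grey by now, so the new
        output is disjoint from the old.\<close>
      moreover have "v \<in> set new \<longleftrightarrow> v < n \<and> col m u = 2 \<and> v \<in> adj u \<and> col m v = 0 \<and> v \<notin> set news" for v
        using that(6) adj_less[OF u(1)] I(8,9) by (cases "v < n") auto
      ultimately have new: "set news \<inter> set new = {}"
        "set (news @ new) = {v. v < n \<and> col m v = 0 \<and> W (n - j) v}"
        using I(8) unfolding u(2) W_Suc by auto
      have m2: "\<forall>v<n. col m2 v = (if col m v = 0 \<and> W (n - j) v then 1 else col m v)"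
        using that(4) I(9) unfolding u(2) W_Suc by simp
      have "(r2 SOURCE + r2 ONE) mod 2 ^ w = n - j"
        using c2 s2 u less_word[of "Suc u"] by (simp add: const_regsD)
      moreover have "Suc (Suc t2) + j * B \<le> t + 1 + n * B" using t2 I(3) by simp
      moreover have "distinct (news @ new)" using I(7) that(5) new(1) by simp
      moreover have "\<forall>x<7. r2 x = r x" using r2 I(4) by simp
      ultimately show ?thesis
        using new(2) m2 that(3) I(1)
        by (intro wp_Alu) (auto simp: I_def simp del: set_append intro!: exI[of _ "news @ new"])
    qed
    show ?case
    proof (rule conjI)
      show "\<not> holds (Eq SOURCE NUM) r'" using I u c by (simp add: const_regsD)
      show "wp w inp (ins (Alu Add VERTEX SOURCE ZERO) ;; access ;; guard (Eq COLOUR TWO) scan ;;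
         ins (Alu Add SOURCE SOURCE ONE)) (\<lambda>t. I j (Suc t)) (Suc t') r' m' os'"
      proof (intro wp_intros, rule wp_access[of _ _ u], goal_cases)
        case 1
        then show ?case by (intro const_regs_frame[OF c]) simp
      next
        case (5 t1 r1)
        have c1: "const_regs r1" using 5 by (intro const_regs_frame[OF c]) simp
        have r1: "\<And>x. x < 9 \<Longrightarrow> r1 x = r' x" using 5 by auto
        show ?case
        proof (rule wp_seqc, rule wp_guard, goal_cases)
          case 1
          then have "col m u = 2" using 5 c1 two by (simp add: const_regsD)
          show ?case
          proof (rule wp_scan[where u = u], goal_cases)
            case (5 t2 r2 m2 new)
            have "wp w inp (ins (Alu Add SOURCE SOURCE ONE)) (\<lambda>t. I j (Suc t)) t2 r2 m2 (os @ news @ new)"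
              using 5 r1 \<open>col m u = 2\<close> \<open>t1 \<le> _\<close>
              by (intro advance) (auto simp: B_def)
            then show ?case using I(6) by simp
          qed (use c1 r1 I u in auto)
        next
          case 2
          then have "col m u \<noteq> 2" using 5 c1 two by (simp add: const_regsD)
          then have "wp w inp (ins (Alu Add SOURCE SOURCE ONE)) (\<lambda>t. I j (Suc t)) (t1 + 2) r1 m' (os @ news @ [])"
            using 5(1) r1 I by (intro advance) (auto simp: B_def)
          then show ?case using I(6) by simp
        qed
      qed (use I u c less_word[of u] in \<open>auto simp: const_regsD\<close>)
    qed
  qed
qed

text \<open>The bounds in \<open>trits\<close> locate the change of the loop test:
  \<open>3 ^ k < 2 ^ w\<close> makes it fail in the first \<open>k\<close> rounds, and
  \<open>2 ^ w \<le> 3 ^ Suc k\<close> makes it hold after them.\<close>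

lemma wp_trits_loop:
  assumes "r ONE = 1" "r THREE = 3" "r WORD = (2 ^ w - 1) div 3" "r POW = 1" "r TRITS = 0"
    and "\<And>t' r'. \<lbrakk>t' \<le> t + 4 * k + 1; r' TRITS = k; \<And>x. x \<noteq> TRITS \<Longrightarrow> x \<noteq> POW \<Longrightarrow> r' x = r x\<rbrakk>
      \<Longrightarrow> Q t' r' m os"
  shows "wp w inp trits_loop Q t r m os"
  unfolding trits_loop_def
proof (rule wp_until[where j = k and I = "\<lambda>j t' r' m' os'. m' = m \<and> os' = os \<and>
    t' + 4 * j \<le> t + 4 * k \<and> j \<le> k \<and> r' TRITS = k - j \<and> r' POW = 3 ^ (k - j) \<and>
    (\<forall>x. x \<noteq> TRITS \<longrightarrow> x \<noteq> POW \<longrightarrow> r' x = r x)"], goal_cases)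
  case 1
  then show ?case using assms by simp
next
  case (2 t' r' m' os')
  have "(2 ^ w - 1) div 3 < (3::nat) ^ k" using trits(3) three_less_word by (simp add: div_less_iff_less_mult)
  then show ?case using 2 assms(3) by (auto intro!: assms(6))
next
  case (3 j t' r' m' os')
  have "(3::nat) ^ (k - Suc j) * 3 = 3 ^ (k - j)" using 3 by (simp add: Suc_diff_Suc flip: power_Suc2)
  moreover have "(3::nat) ^ (k - j) \<le> 3 ^ k" by (intro power_increasing) auto
  ultimately have le: "(3::nat) ^ (k - Suc j) * 3 < 2 ^ w" "(3::nat) ^ (k - Suc j) * 3 = 3 ^ (k - j)"
    using trits(2) by linarith+
  have "k < 2 ^ w" using trits(2) power_gt_expt[of 3 k] by simp
  then have small: "k - j < 2 ^ w" by simp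
  have "\<not> (2 ^ w - 1) div 3 < (3::nat) ^ (k - Suc j)"
    using le(1) by (simp add: div_less_iff_less_mult)
  then show ?case using 3 assms(1-3) le small
    by (intro conjI wp_intros) (auto simp: Suc_diff_Suc)
qed

end

section \<open>Breadth-first levels\<close>

text \<open>The ball of radius \<open>i\<close> around \<open>s\<close>, in the recursive form that
  one phase of the program carries out.\<close>

fun near :: "('a \<Rightarrow> 'a set) \<Rightarrow> 'a \<Rightarrow> nat \<Rightarrow> 'a set" where
  "near adj s 0 = {s}"
| "near adj s (Suc i) = near adj s i \<union> (\<Union>u\<in>near adj s i. adj u)"

lemma near_mono: "i \<le> j \<Longrightarrow> near adj s i \<subseteq> near adj s j"
  by (rule lift_Suc_mono_le[of "near adj s"]) auto

context wf_digraph begin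

text \<open>A walk of length at most \<open>Suc i\<close> is one of length at most \<open>i\<close>,
  possibly extended by a last arc; this is the recursion of \<open>near\<close>.\<close>

lemma near_iff_awalk:
  assumes "s \<in> verts G"
  shows "v \<in> near (\<lambda>u. {v. (u, v) \<in> arcs_ends G}) s i \<longleftrightarrow> (\<exists>p. awalk s p v \<and> length p \<le> i)"
proof (induction i arbitrary: v)
  case 0
  then show ?case using assms by (auto simp: awalk_Nil_iff)
next
  case (Suc i)
  show ?case
  proof
    assume "v \<in> near (\<lambda>u. {v. (u, v) \<in> arcs_ends G}) s (Suc i)"
    then consider p where "awalk s p v" "length p \<le> i"
      | u p where "awalk s p u" "length p \<le> i" "(u, v) \<in> arcs_ends G"
      using Suc.IH by auto
    then show "\<exists>p. awalk s p v \<and> length p \<le> Suc i"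
    proof cases
      case 1
      then show ?thesis by (intro exI[of _ p]) simp
    next
      case 2
      from 2(3) obtain e where e: "e \<in> arcs G" "tail G e = u" "head G e = v"
        by (auto simp: arcs_ends_conv)
      then have "awalk s (p @ [e]) v"
        using 2(1) by (auto simp: awalk_simps)
      then show ?thesis using 2(2) by (intro exI[of _ "p @ [e]"]) simp
    qed
  next
    assume "\<exists>p. awalk s p v \<and> length p \<le> Suc i"
    then obtain p where p: "awalk s p v" "length p \<le> Suc i" by blast
    show "v \<in> near (\<lambda>u. {v. (u, v) \<in> arcs_ends G}) s (Suc i)"
    proof (cases p rule: rev_cases)
      case Nil
      then have "\<exists>p. awalk s p v \<and> length p \<le> i" using p(1) by (intro exI[of _ p]) simp
      then show ?thesis using Suc.IH by simp
    next
      case (snoc q e)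
      then have "awalk s q (tail G e)" "e \<in> arcs G" "head G e = v"
        using p(1) by (auto simp: awalk_simps)
      moreover have "length q \<le> i" using p(2) snoc by simp
      ultimately have "tail G e \<in> near (\<lambda>u. {v. (u, v) \<in> arcs_ends G}) s i"
        using Suc.IH by blast
      moreover have "(tail G e, v) \<in> arcs_ends G"
        using \<open>e \<in> arcs G\<close> \<open>head G e = v\<close> by (auto simp: arcs_ends_conv)
      ultimately show ?thesis by auto
    qed
  qed
qed

text \<open>Under unit weights the cost of a walk is its length. Each walk to \<open>v\<close> is
  therefore matched by a walk to \<open>u\<close> that is no longer, and the infima compare without
  being evaluated.\<close>

lemma mu_unit_mono:
  assumes "s \<in> verts G"
    and "\<And>i. v \<in> near (\<lambda>u. {v. (u, v) \<in> arcs_ends G}) s i \<Longrightarrow>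
      u \<in> near (\<lambda>u. {v. (u, v) \<in> arcs_ends G}) s i"
  shows "\<mu> (\<lambda>_. 1) s u \<le> \<mu> (\<lambda>_. 1) s v"
proof -
  have cost: "awalk_cost (\<lambda>_. 1) p = real (length p)" for p
    by (induction p) auto
  have "\<exists>q\<in>{q. awalk s q u}. ereal (awalk_cost (\<lambda>_. 1) q) \<le> ereal (awalk_cost (\<lambda>_. 1) p)"
    if "awalk s p v" for p
  proof -
    have "v \<in> near (\<lambda>u. {v. (u, v) \<in> arcs_ends G}) s (length p)"
      unfolding near_iff_awalk[OF assms(1)] using that by blast
    from assms(2)[OF this] show ?thesis
      unfolding near_iff_awalk[OF assms(1)] cost by auto
  qed
  then show ?thesis unfolding \<mu>_def by (intro INF_mono) auto
qed

end

text \<open>A reachable vertex is the end of a path without repeated vertices, whose length is at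
  most the number of vertices.\<close>

lemma (in fin_digraph) near_card_verts:
  assumes "s \<in> verts G"
  shows "near (\<lambda>u. {v. (u, v) \<in> arcs_ends G}) s (card (verts G)) = {v. s \<rightarrow>\<^sup>* v}"
proof (intro set_eqI iffI)
  fix v assume "v \<in> {v. s \<rightarrow>\<^sup>* v}"
  then obtain p where "apath s p v" unfolding reachable_apath by blast
  then show "v \<in> near (\<lambda>u. {v. (u, v) \<in> arcs_ends G}) s (card (verts G))"
    unfolding near_iff_awalk[OF assms] using length_apath[of s p v] awalkI_apath by blast
qed (auto simp: near_iff_awalk[OF assms] reachable_awalk)

section \<open>The phases of the search\<close>

context bfs_input begin

lemma near_less: "near adj s i \<subseteq> {..<n}"
  using inp(5) adj_less by (induction i) auto

text \<open>All vertices are white at first and \<open>bump\<close> colours \<open>s\<close> alone,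
  so the nonwhite vertices and the output both start as the ball of radius \<open>0\<close>.\<close>

lemma wp_prepare:
  assumes "\<And>t' r' m'. \<lbrakk>t' \<le> t + 8 * k + 20; const_regs r'; r' PHASE = 0; good m';
      \<And>v. v < n \<Longrightarrow> col m' v \<noteq> 0 \<longleftrightarrow> v = s\<rbrakk> \<Longrightarrow> Q t' r' m' [s]"
  shows "wp w inp prepare Q t (\<lambda>_. 0) (replicate (n div k + 1) 0) []"
proof -
  let ?m = "replicate (n div k + 1) (0::nat)"
  have m: "good ?m" using trits by (auto simp: good_def)
  have col: "v < n \<Longrightarrow> col ?m v = 0" for v using cell_less[OF m] by (simp add: col_def del: replicate_Suc)
  have z: "0 < length inp" "Suc 0 < length inp" using inp by auto
  note small = three_less_word word_ge inp z
  show ?thesis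
    unfolding prepare_def
  proof (intro wp_intros, goal_cases)
    case 1
    then show ?case using z by simp
  next
    case 2
    show ?case
    proof (rule wp_trits_loop, goal_cases)
      case (6 t1 r1)
      have c: "const_regs r1" using 6 small unfolding const_regs_def by simp
      show ?case
      proof (intro wp_intros, goal_cases)
        case 1
        then show ?case using c z by (simp add: const_regsD)
      next
        case 2
        show ?case
        proof (rule wp_access[where v = s], goal_cases)
          case 1
          then show ?case by (intro const_regs_frame[OF c]) simp
        next
          case (5 t2 r2)
          have c2: "const_regs r2" using 5 by (intro const_regs_frame[OF c]) simp
          have r2: "r2 VERTEX = s" "r2 PHASE = 0" using 5 6 c inp by (auto simp: const_regsD)
          show ?case
          proof (intro wp_seqc, rule wp_bump[where v = s], goal_cases)
            case (7 r3)
            have c3: "const_regs r3" using 7 by (intro const_regs_frame[OF c2]) simp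
            have r3: "r3 VERTEX = s" "r3 PHASE = 0" using 7 r2 by auto
            have "Q (Suc (t2 + 2)) r3 (incr ?m s) [s]"
              using c3 r3 5(1) 6(1) inp(5) m col
              by (intro assms) (auto simp: good_incr col_incr)
            then show ?case using r3 by (intro wp_Write) simp
          qed (use 5 m col inp in auto)
        qed (use c m inp in \<open>auto simp: const_regsD\<close>)
      qed
    qed (use small in auto)
  qed
qed

text \<open>Sum of the bounds for \<open>promote\<close> and \<open>expand\<close>. The
  \<open>7\<close> consists of their constants \<open>2\<close> and \<open>2\<close>, the increment
  of \<open>PHASE\<close>, and the test and jump of the outer loop.\<close>

definition phase_time :: nat where
  "phase_time = n * (4 * k + 12) + n * (n * (4 * k + 16) + 4 * k + 16) + 7"

text \<open>Only white versus nonwhite is tracked between phases: promotion makes the whole ball of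
  radius \<open>i\<close> black, and its white out-neighbours complete the next ball. The
  \<open>2\<close> in the time bound is left for the test and jump of the outer loop.\<close>

lemma wp_phase:
  assumes "const_regs r" "good m" "\<And>v. v < n \<Longrightarrow> col m v \<noteq> 0 \<longleftrightarrow> v \<in> near adj s i"
    and "r PHASE = i" "i < n"
    and "\<And>t' r' m' news. \<lbrakk>t' + 2 \<le> t + phase_time; const_regs r'; r' PHASE = Suc i; good m';
        \<And>v. v < n \<Longrightarrow> col m' v \<noteq> 0 \<longleftrightarrow> v \<in> near adj s (Suc i); distinct news;
        set news = near adj s (Suc i) - near adj s i\<rbrakk> \<Longrightarrow> Q t' r' m' (os @ news)"
  shows "wp w inp (promote ;; expand ;; ins (Alu Add PHASE PHASE ONE)) Q t r m os"
proof (rule wp_seqc, rule wp_promote[OF assms(1,2)], goal_cases)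
  case (1 t1 r1 m1)
  have c1: "const_regs r1" using 1 by (intro const_regs_frame[OF assms(1)]) simp
  have black: "col m1 u = 2 \<longleftrightarrow> u \<in> near adj s i"
    and white: "col m1 u = 0 \<longleftrightarrow> u \<notin> near adj s i" if "u < n" for u
    unfolding assms(3)[OF that, symmetric] 1(4)[OF that] by simp_all
  define E where "E v \<longleftrightarrow> (\<exists>u<n. col m1 u = 2 \<and> v \<in> adj u)" for v
  have reach: "v \<in> near adj s (Suc i) \<longleftrightarrow> v \<in> near adj s i \<or> E v" for v
  proof -
    have "E v \<longleftrightarrow> (\<exists>u\<in>near adj s i. v \<in> adj u)"
      unfolding E_def using black near_less[of i] by blast
    then show ?thesis by simp
  qed
  show ?case
  proof (rule wp_seqc, rule wp_expand[OF c1 1(3)], goal_cases)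
    case 1
    then show ?case using \<open>\<And>v. v < n \<Longrightarrow> col m1 v = _ v\<close> by simp
  next
    case (2 t2 r2 m2 news)
    have c2: "const_regs r2" using 2 by (intro const_regs_frame[OF c1]) simp
    have news: "set news = near adj s (Suc i) - near adj s i"
    proof (rule set_eqI)
      fix v
      have "v \<in> set news \<longleftrightarrow> v < n \<and> col m1 v = 0 \<and> E v"
        unfolding 2(6) E_def by (rule mem_Collect_eq)
      also have "\<dots> \<longleftrightarrow> v \<in> near adj s (Suc i) \<and> v \<notin> near adj s i"
        using reach[of v] white[of v] near_less[of "Suc i"] by blast
      finally show "v \<in> set news \<longleftrightarrow> v \<in> near adj s (Suc i) - near adj s i" by (simp only: Diff_iff)
    qed
    have m2: "col m2 v \<noteq> 0 \<longleftrightarrow> v \<in> near adj s (Suc i)" if "v < n" for v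
    proof -
      have "col m2 v = (if col m1 v = 0 \<and> E v then 1 else col m1 v)"
        unfolding E_def by (rule 2(4)[OF that])
      then show ?thesis unfolding reach using white[OF that] by (cases "E v") auto
    qed
    have ph: "r2 PHASE = i" using 2(2)[of 6] 1(2)[of 6] assms(4) by simp
    show ?case
    proof (intro wp_Alu assms(6))
      show "Suc t2 + 2 \<le> t + phase_time" using 2(1) 1(1) by (simp add: phase_time_def)
      show "(r2(PHASE := alu_op Add w (r2 PHASE) (r2 ONE))) PHASE = Suc i"
        using ph c2 assms(5) less_word[of "Suc i"] by (simp add: const_regsD)
      show "const_regs (r2(PHASE := alu_op Add w (r2 PHASE) (r2 ONE)))"
        by (intro const_regs_frame[OF c2]) simp
    qed (use 2 news m2 in auto)
  qed
qed

text \<open>The relation compares distances through balls. A vertex of \<open>news\<close> lies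
  outside the ball of radius \<open>i\<close>, so every ball containing it has radius at least
  \<open>Suc i\<close> and contains all of \<open>os @ news\<close>.\<close>

lemma sorted_near_append:
  assumes "sorted_wrt (\<lambda>u v. \<forall>i. v \<in> near adj s i \<longrightarrow> u \<in> near adj s i) os"
    and "set os = near adj s i" "set news = near adj s (Suc i) - near adj s i"
  shows "sorted_wrt (\<lambda>u v. \<forall>i. v \<in> near adj s i \<longrightarrow> u \<in> near adj s i) (os @ news)"
proof -
  let ?R = "\<lambda>u v. \<forall>j. v \<in> near adj s j \<longrightarrow> u \<in> near adj s j"
  have R: "?R u v" if "u \<in> near adj s (Suc i)" "v \<in> set news" for u v
  proof (intro allI impI)
    fix j assume v: "v \<in> near adj s j"
    have "v \<notin> near adj s i" using that(2) by (simp add: assms(3))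
    then have "\<not> j \<le> i" using v near_mono by (meson subsetD)
    then have "Suc i \<le> j" by simp
    from subsetD[OF near_mono[OF this] that(1)] show "u \<in> near adj s j" .
  qed
  have news: "sorted_wrt ?R news"
    unfolding sorted_wrt_iff_nth_less
  proof (rule allI, rule allI, rule impI, rule impI)
    fix a b assume "a < b" "b < length news"
    then have "news ! a \<in> near adj s (Suc i)" "news ! b \<in> set news"
      unfolding assms(3)[symmetric] using nth_mem[of a news] nth_mem[of b news] assms(3)
      by (simp_all del: near.simps)
    then show "?R (news ! a) (news ! b)" by (rule R)
  qed
  have "\<forall>u\<in>set os. \<forall>v\<in>set news. ?R u v"
    by (rule ballI, rule ballI, rule R) (simp_all add: assms(2))
  with assms(1) news show ?thesis
    by (intro sorted_wrt_append[THEN iffD2] conjI)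
qed

text \<open>With \<open>j\<close> phases left, the output is the ball of radius
  \<open>n - j\<close>, ordered by distance. The \<open>21\<close> is the \<open>20\<close> of
  \<open>wp_prepare\<close> plus the last loop test.\<close>

lemma wp_bfs:
  assumes "\<And>t r m os. \<lbrakk>t \<le> 8 * k + 21 + n * phase_time; distinct os; set os = near adj s n;
      sorted_wrt (\<lambda>u v. \<forall>i. v \<in> near adj s i \<longrightarrow> u \<in> near adj s i) os\<rbrakk> \<Longrightarrow> Q t r m os"
  shows "wp w inp bfs Q 0 (\<lambda>_. 0) (replicate (n div k + 1) 0) []"
  unfolding bfs_def
proof (rule wp_seqc, rule wp_prepare, rule wp_until[where j = n and I = "\<lambda>j t r m os. j \<le> n \<and>
    t + j * phase_time \<le> 8 * k + 20 + n * phase_time \<and> const_regs r \<and> r PHASE = n - j \<and> good m \<and>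
    (\<forall>v<n. col m v \<noteq> 0 \<longleftrightarrow> v \<in> near adj s (n - j)) \<and> distinct os \<and> set os = near adj s (n - j) \<and>
    sorted_wrt (\<lambda>u v. \<forall>i. v \<in> near adj s i \<longrightarrow> u \<in> near adj s i) os"], goal_cases)
  case (1 t' r' m')
  then show ?case by simp
next
  case (2 t' r' m' t r m os)
  then have "t \<le> 8 * k + 20 + n * phase_time" "holds (Eq PHASE NUM) r" by (simp_all add: const_regsD)
  then show ?case using 2 by (intro conjI assms) simp_all
next
  case (3 t' r' m' j t r m os)
  let ?i = "n - Suc j"
  have i: "?i < n" "n - j = Suc ?i" using 3 by auto
  show ?case
  proof (rule conjI, goal_cases)
    case 1
    then show ?case using 3 i by (simp add: const_regsD)
  next
    case 2
    show ?case
    proof (rule wp_phase[where i = ?i], goal_cases)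
      case (6 t1 r1 m1 news)
      have "distinct (os @ news)" "set (os @ news) = near adj s (Suc ?i)"
        using 6(6,7) 3 by auto
      moreover have "sorted_wrt (\<lambda>u v. \<forall>i. v \<in> near adj s i \<longrightarrow> u \<in> near adj s i) (os @ news)"
        using 6(7) 3 by (intro sorted_near_append) auto
      moreover have "Suc t1 + j * phase_time \<le> 8 * k + 20 + n * phase_time"
        using 6(1) 3 by simp
      ultimately show ?case
        using 6(2-5) 3 unfolding i(2) by (intro conjI) (simp_all del: near.simps)
    qed (use 3 i in auto)
  qed
qed

end

section \<open>Running time and space\<close>

text \<open>Quantifying over all placements makes the notion compositional for \<open>;;\<close>,
  \<open>until\<close> and \<open>guard\<close>.\<close>

definition uses :: "reg set \<Rightarrow> code \<Rightarrow> bool" where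
  "uses R C \<longleftrightarrow> (\<forall>a. \<forall>i\<in>set (C a). regs_of i \<subseteq> R)"

text \<open>The target \<open>0\<close> is a dummy: the registers of a jump do not depend on where
  it leads.\<close>

lemma uses_intros:
  "regs_of i \<subseteq> R \<Longrightarrow> uses R (ins i)"
  "uses R C \<Longrightarrow> uses R D \<Longrightarrow> uses R (C ;; D)"
  "regs_of (jump_if b 0) \<subseteq> R \<Longrightarrow> uses R C \<Longrightarrow> uses R (until b C)"
  "regs_of (jump_if b 0) \<subseteq> R \<Longrightarrow> uses R C \<Longrightarrow> uses R (guard b C)"
  by (cases b; fastforce simp: uses_def ins_def seqc_def until_def guard_def)+

lemma uses_bfs: "uses {..<15} bfs"
  unfolding bfs_def prepare_def promote_def expand_def scan_def access_def bump_def
    trits_loop_def power_loop_def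
  by (intro uses_intros) auto

lemma card_regs_bfs: "card (\<Union> (regs_of ` set (bfs 0 @ [Halt]))) \<le> 15"
proof -
  have "\<Union> (regs_of ` set (bfs 0 @ [Halt])) \<subseteq> {..<15}"
    using uses_bfs unfolding uses_def by fastforce
  from card_mono[OF _ this] show ?thesis by simp
qed

lemma (in bfs_input) halts_bfs:
  "\<exists>t os. halts_with (bfs 0 @ [Halt]) w inp (n div k + 1) t os \<and> t \<le> 8 * k + 21 + n * phase_time \<and>
    distinct os \<and> set os = near adj s n \<and>
    sorted_wrt (\<lambda>u v. \<forall>i. v \<in> near adj s i \<longrightarrow> u \<in> near adj s i) os"
proof -
  let ?Q = "\<lambda>t r m os. t \<le> 8 * k + 21 + n * phase_time \<and> distinct os \<and> set os = near adj s n \<and>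
      sorted_wrt (\<lambda>u v. \<forall>i. v \<in> near adj s i \<longrightarrow> u \<in> near adj s i) os"
  have "wp w inp bfs ?Q 0 (\<lambda>_. 0) (replicate (n div k + 1) 0) []"
    by (rule wp_bfs) blast
  moreover have "code_at (bfs 0 @ [Halt]) 0 (bfs 0)"
    unfolding code_at_def by (intro exI[of _ "[]"] exI[of _ "[Halt]"]) simp
  ultimately obtain t r m os where
    "run (bfs 0 @ [Halt]) w inp t (init (n div k + 1)) = Some (state (length (bfs 0)) r m os)"
    "?Q t r m os"
    unfolding wp_def init_def state_def by fastforce
  then show ?thesis
    unfolding halts_with_def by (intro exI[of _ t] exI[of _ os] conjI) (auto simp: state_def)
qed

lemma (in bfs_input) time_bound:
  assumes "k \<le> C * n" "0 < C"
  shows "8 * k + 21 + n * phase_time \<le> 92 * C * n ^ 4"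
proof -
  define X where "X = C * n ^ 4"
  have n: "1 \<le> n" using inp by simp
  have p: "n ^ j \<le> X" if "j \<le> 4" for j
  proof -
    have "n ^ j \<le> n ^ 4" using n that by (intro power_increasing) auto
    also have "\<dots> \<le> X" using assms(2) by (simp add: X_def)
    finally show ?thesis .
  qed
  have q: "n ^ j * k \<le> X" if "j \<le> 3" for j
  proof -
    have "n ^ j * k \<le> n ^ 3 * (C * n)"
      using n that assms(1) by (intro mult_mono power_increasing) auto
    also have "\<dots> = X" by (simp add: X_def power_Suc numeral_eq_Suc)
    finally show ?thesis .
  qed
  have "8 * k + 21 + n * phase_time =
      8 * k + 21 + 8 * (n ^ 2 * k) + 28 * n ^ 2 + 4 * (n ^ 3 * k) + 16 * n ^ 3 + 7 * n"
    by (simp add: phase_time_def algebra_simps power2_eq_square power3_eq_cube)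
  \<comment> \<open>Every monomial is at most \<open>X\<close>, and the coefficients 8, 21, 8, 28,
    4, 16 and 7 add up to \<open>92\<close>.\<close>
  also have "\<dots> \<le> 92 * X"
    using p[of 0] p[of 1] p[of 2] p[of 3] q[of 0] q[of 2] q[of 3] by simp
  finally show ?thesis by (simp add: X_def)
qed

section \<open>Space bound and asymptotics of the word length\<close>

lemma log_2_3_le: "log 2 3 \<le> (2::real)"
proof -
  have "log 2 3 \<le> log 2 (4::real)" by (subst log_le_cancel_iff) auto
  also have "log 2 (4::real) = 2" using log_nat_power[of 2 2 2] by simp
  finally show ?thesis .
qed

text \<open>Taking logarithms shows that \<open>k\<close> digits waste at most
  \<open>log 2 3\<close> bits of a word. The cruder second bound uses
  \<open>Suc k \<le> 2 * k\<close> and \<open>log 2 3 \<le> 2\<close>; it serves to express the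
  total waste in terms of \<open>w\<close>.\<close>

lemma trits_bounds:
  assumes "0 < k" "(2::nat) ^ w \<le> 3 ^ Suc k"
  shows "real w \<le> real (Suc k) * log 2 3" "real w \<le> 4 * real k"
proof -
  have "real (2 ^ w) \<le> real (3 ^ Suc k)" using assms(2) by (simp only: of_nat_le_iff)
  then have "log 2 (2 ^ w) \<le> log 2 (3 ^ Suc k)" by (subst log_le_cancel_iff) auto
  then show 1: "real w \<le> real (Suc k) * log 2 3" by (simp add: log_nat_power del: power_Suc)
  have "real (Suc k) * log 2 3 \<le> real (Suc k) * 2" using log_2_3_le by (intro mult_left_mono) auto
  then show "real w \<le> 4 * real k" using 1 assms(1) by simp
qed

text \<open>Besides \<open>n * log 2 3\<close> bits, the roughly \<open>n / k\<close> words
  contribute a waste of \<open>log 2 3\<close> bits each, at most \<open>8 * n / w\<close> in total.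
  The \<open>16\<close> counts up to fifteen registers and the extra cell.\<close>

lemma ternary_words_space:
  assumes "0 < k" "(2::nat) ^ w \<le> 3 ^ Suc k" "0 < w" "c \<le> 15"
  shows "real ((c + (n div k + 1)) * w) \<le> real n * log 2 3 + (16 * real w + 8 * real n / real w)"
proof -
  note b = trits_bounds[OF assms(1,2)]
  have "real (n div k) \<le> real n / real k" by (rule of_nat_div_le_of_nat)
  then have "real (c + (n div k + 1)) \<le> 16 + real n / real k" using assms(4) by simp
  then have "real ((c + (n div k + 1)) * w) \<le> (16 + real n / real k) * real w"
    unfolding of_nat_mult by (intro mult_right_mono) auto
  also have "\<dots> = 16 * real w + real n / real k * real w" by (simp add: algebra_simps)
  also have "real n / real k * real w \<le> real n / real k * (real (Suc k) * log 2 3)"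
    using b(1) by (intro mult_left_mono) auto
  also have "\<dots> = real n * log 2 3 + real n * (log 2 3 / real k)"
    using assms(1) by (simp add: field_simps)
  also have "log 2 3 / real k \<le> 8 / real w"
  proof -
    have "log 2 3 / real k \<le> 2 / real k" using log_2_3_le by (intro divide_right_mono) auto
    also have "\<dots> \<le> 8 / real w" using b(2) assms(1,3) by (simp add: field_simps)
    finally show ?thesis .
  qed
  then have "real n * (log 2 3 / real k) \<le> real n * (8 / real w)" by (intro mult_left_mono) auto
  finally show ?thesis by (simp add: algebra_simps)
qed

lemma word_length_at_top:
  assumes "word_length w"
  shows "filterlim (\<lambda>n. real (w n)) at_top at_top"
proof -
  from assms obtain c where c: "c > 0"
    "eventually (\<lambda>n. c * norm (log 2 (real n)) \<le> norm (real (w n))) at_top"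
    unfolding word_length_def by (auto elim!: landau_omega.bigE)
  have "filterlim (\<lambda>n. c / ln 2 * ln (real n)) at_top at_top"
    using c(1) by (intro filterlim_tendsto_pos_mult_at_top[OF tendsto_const]
      filterlim_compose[OF ln_at_top filterlim_real_sequentially]) auto
  moreover have "eventually (\<lambda>n. c / ln 2 * ln (real n) \<le> real (w n)) at_top"
    using c(2)
  proof eventually_elim
    case (elim n)
    have "c * log 2 (real n) \<le> c * norm (log 2 (real n))" using c(1) by (intro mult_left_mono) auto
    with elim show ?case by (simp add: log_def)
  qed
  ultimately show ?thesis by (rule filterlim_at_top_mono)
qed

text \<open>Both halves of \<open>word_length\<close> enter: sublinearity handles
  \<open>16 * w\<close>, and the logarithmic lower bound makes \<open>w\<close> tend to infinity, so
  that \<open>8 * n / w\<close> is sublinear.\<close>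

lemma word_length_overhead:
  assumes "word_length w"
  shows "(\<lambda>n. 16 * real (w n) + 8 * real n / real (w n)) \<in> o(\<lambda>n. real n)"
proof -
  have "(\<lambda>n. 8 * real n / real (w n)) \<in> o(\<lambda>n. real n)"
  proof (rule landau_o.smallI)
    fix c :: real assume "c > 0"
    have "eventually (\<lambda>n. 8 / c + 1 \<le> real (w n)) at_top"
      using word_length_at_top[OF assms] unfolding filterlim_at_top by blast
    then show "eventually (\<lambda>n. norm (8 * real n / real (w n)) \<le> c * norm (real n)) at_top"
    proof eventually_elim
      case (elim n)
      have "8 / c > 0" using \<open>c > 0\<close> by simp
      then have w: "0 < real (w n)" "8 / c \<le> real (w n)" using elim by linarith+
      then have "8 / real (w n) \<le> c" using \<open>c > 0\<close> by (simp add: field_simps)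
      then have "8 / real (w n) * real n \<le> c * real n" by (intro mult_right_mono) auto
      then show ?case by (simp add: mult.commute)
    qed
  qed
  moreover have "(\<lambda>n. 16 * real (w n)) \<in> o(\<lambda>n. real n)"
    using assms unfolding word_length_def by simp
  ultimately show ?thesis by (intro sum_in_smallo)
qed

text \<open>From some \<open>m\<close> on even \<open>w n \<le> n\<close> holds; the sum absorbs the
  finitely many exceptions. The time bound has to hold for every graph, not only for large
  ones.\<close>

lemma word_length_linear:
  assumes "word_length w"
  obtains C where "0 < C" "\<And>n. 0 < n \<Longrightarrow> w n \<le> C * n"
proof -
  have "eventually (\<lambda>n. norm (real (w n)) \<le> 1 * norm (real n)) at_top"
    using assms unfolding word_length_def by (auto dest: landau_o.smallD[of _ _ _ 1])
  then obtain m where m: "\<And>n. n \<ge> m \<Longrightarrow> w n \<le> n" by (auto simp: eventually_at_top_linorder)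
  show thesis
  proof (rule that[of "1 + (\<Sum>i<m. w i)"])
    fix n :: nat assume n: "0 < n"
    show "w n \<le> (1 + (\<Sum>i<m. w i)) * n"
    proof (cases "n < m")
      case True
      then have "w n \<le> (\<Sum>i<m. w i)" by (intro member_le_sum) auto
      also have "\<dots> \<le> (\<Sum>i<m. w i) * n" using n by simp
      finally show ?thesis by simp
    next
      case False
      then show ?thesis using m[of n] by simp
    qed
  qed simp
qed

section \<open>From adjacency lists and balls to the theorem\<close>

lemma bfs_input_of_adjacency_list:
  assumes "pair_fin_digraph G" "adjacency_list G s inp" "fits_words w inp" "n = card (pverts G)"
  obtains k where "bfs_input w k inp n s (\<lambda>u. {v. (u, v) \<in> parcs G})" "k \<le> w"
proof -
  interpret pair_fin_digraph G by fact
  have V: "pverts G = {0..<n}" "s < n" and len: "n + 2 \<le> length inp" "inp ! 0 = n" "inp ! 1 = s"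
    and xs: "\<And>v. v < n \<Longrightarrow> \<exists>xs. linked_list inp (inp ! (v + 2)) xs \<and> distinct xs \<and>
        set xs = {u. (v, u) \<in> parcs G}"
    using assms(2) unfolding adjacency_list_def assms(4) Let_def by auto
  have l2: "length inp \<le> 2 ^ w" using assms(3) by (simp add: fits_words_def)
  \<comment> \<open>As \<open>s < n\<close> forces \<open>1 \<le> n\<close>, the input has at least
    three cells.\<close>
  then have w: "3 \<le> (2::nat) ^ w" using len V by linarith
  have "1 \<le> (2::nat) ^ w - 1" using w by linarith
  \<comment> \<open>The power is located relative to \<open>2 ^ w - 1\<close>, which makes
    \<open>3 ^ k < 2 ^ w\<close> strict.\<close>
  from ex_power_ivl1[of 3, OF _ this] obtain k where k: "3 ^ k \<le> (2::nat) ^ w - 1" "(2::nat) ^ w - 1 < 3 ^ (k + 1)"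
    by auto
  have "2 \<le> w"
  proof (rule ccontr)
    assume "\<not> 2 \<le> w"
    then have "(2::nat) ^ w \<le> 2 ^ 1" by (intro power_increasing) auto
    then show False using w by simp
  qed
  then have "(2::nat) ^ 2 \<le> 2 ^ w" by (intro power_increasing) auto
  then have "0 < k" using k(2) by (cases k) auto
  have "(2::nat) ^ k \<le> 3 ^ k" by (intro power_mono) auto
  then have "(2::nat) ^ k < 2 ^ w" using k(1) w by linarith
  then have "k \<le> w" by simp
  moreover have "bfs_input w k inp n s (\<lambda>u. {v. (u, v) \<in> parcs G})"
  proof
    show "3 ^ k < (2::nat) ^ w" "2 ^ w \<le> (3::nat) ^ Suc k" using k w by simp_all
    show "{u. (v, u) \<in> parcs G} \<subseteq> {..<n}" for v using in_arcsD2 V(1) by auto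
  qed (use \<open>0 < k\<close> l2 V len xs in auto)
  ultimately show thesis using that by blast
qed

text \<open>The ordering by balls becomes one by distance through \<open>mu_unit_mono\<close>, and
  the last ball becomes the set of reachable vertices through
  \<open>near_card_verts\<close>.\<close>

lemma bfs_order_near:
  fixes G :: "'a pair_pre_digraph"
  defines "adj \<equiv> \<lambda>u. {v. (u, v) \<in> parcs G}"
  assumes "pair_fin_digraph G" "s \<in> pverts G" "distinct os" "set os = near adj s (card (pverts G))"
    and "sorted_wrt (\<lambda>u v. \<forall>i. v \<in> near adj s i \<longrightarrow> u \<in> near adj s i) os"
  shows "bfs_order G s os"
proof -
  interpret pair_fin_digraph G by fact
  have "distance G s u \<le> distance G s v" if "\<forall>i. v \<in> near adj s i \<longrightarrow> u \<in> near adj s i" for u v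
    unfolding distance_def using mu_unit_mono[of s v u] assms(3) that unfolding adj_def by simp
  then have "sorted_wrt (\<lambda>u v. distance G s u \<le> distance G s v) os"
    by (intro sorted_wrt_mono_rel[OF _ assms(6)])
  moreover have "near adj s (card (pverts G)) = {v. s \<rightarrow>\<^sup>*\<^bsub>with_proj G\<^esub> v}"
    using near_card_verts[of s] assms(3) unfolding adj_def by simp
  ultimately show ?thesis using assms(4,5) by (simp add: bfs_order_def)
qed

theorem theorem6:
  shows "\<exists>P :: instr list. \<forall>w :: nat \<Rightarrow> nat. word_length w \<longrightarrow>
    (\<exists>(c::nat) (d::nat) (e :: nat \<Rightarrow> real). e \<in> o(\<lambda>n. real n) \<and>
      (\<forall>(G :: nat pair_pre_digraph) s inp n.
        pair_fin_digraph G \<longrightarrow> Digraph_Component.connected (with_proj G) \<longrightarrow>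
        n = card (pverts G) \<longrightarrow> adjacency_list G s inp \<longrightarrow> fits_words (w n) inp \<longrightarrow>
        (\<exists>M t vs. halts_with P (w n) inp M t vs \<and> bfs_order G s vs \<and>
          t \<le> c * n ^ d \<and>
          real (space_bits P (w n) M) \<le> real n * log 2 3 + e n)))"
proof (intro exI[of _ "bfs 0 @ [Halt]"] allI impI)
  fix w :: "nat \<Rightarrow> nat" assume w: "word_length w"
  \<comment> \<open>The program is already fixed; only the constant \<open>C\<close> and the error
    term \<open>e\<close> depend on the word length function.\<close>
  obtain C where C: "0 < C" "\<And>n. 0 < n \<Longrightarrow> w n \<le> C * n" using word_length_linear[OF w] by blast
  define e where "e n = 16 * real (w n) + 8 * real n / real (w n)" for n
  have "e \<in> o(\<lambda>n. real n)" unfolding e_def by (rule word_length_overhead[OF w])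
  moreover have "\<exists>M t vs. halts_with (bfs 0 @ [Halt]) (w n) inp M t vs \<and> bfs_order G s vs \<and>
      t \<le> 92 * C * n ^ 4 \<and> real (space_bits (bfs 0 @ [Halt]) (w n) M) \<le> real n * log 2 3 + e n"
    if G: "pair_fin_digraph G" "n = card (pverts G)" "adjacency_list G s inp" "fits_words (w n) inp"
    for G :: "nat pair_pre_digraph" and s inp n
  proof -
    obtain k where k: "bfs_input (w n) k inp n s (\<lambda>u. {v. (u, v) \<in> parcs G})" "k \<le> w n"
      using bfs_input_of_adjacency_list[OF G(1,3,4,2)] by blast
    interpret bfs_input "w n" k inp n s "\<lambda>u. {v. (u, v) \<in> parcs G}" by (rule k(1))
    have "k \<le> C * n" using k(2) C(2)[of n] inp(5) by linarith
    note time = time_bound[OF this C(1)]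
    have "s \<in> pverts G" using G(3) by (simp add: adjacency_list_def Let_def)
    note order = bfs_order_near[OF G(1) this, folded G(2)]
    have space: "real (space_bits (bfs 0 @ [Halt]) (w n) (n div k + 1)) \<le> real n * log 2 3 + e n"
      unfolding space_bits_def e_def using word_ge
      by (intro ternary_words_space trits card_regs_bfs) simp
    show ?thesis using halts_bfs time order space by (meson le_trans)
  qed
  ultimately show "\<exists>(c::nat) (d::nat) (e :: nat \<Rightarrow> real). e \<in> o(\<lambda>n. real n) \<and>
      (\<forall>(G :: nat pair_pre_digraph) s inp n.
        pair_fin_digraph G \<longrightarrow> Digraph_Component.connected (with_proj G) \<longrightarrow>
        n = card (pverts G) \<longrightarrow> adjacency_list G s inp \<longrightarrow> fits_words (w n) inp \<longrightarrow>
        (\<exists>M t vs. halts_with (bfs 0 @ [Halt]) (w n) inp M t vs \<and> bfs_order G s vs \<and>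
          t \<le> c * n ^ d \<and>
          real (space_bits (bfs 0 @ [Halt]) (w n) M) \<le> real n * log 2 3 + e n))"
    by blast
qed

end
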